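(* There is an absolute constant $C$ such that the following holds. Let $f\colon\{-1,1\}^{n}\rightarrow [-1,1]$ be a symmetric function of degree $d$. If $n\geq 64d^{4}\log d$, then $\mathrm{Inf}[f]\leq d+C\sqrt{dn}\,e^{-t^{2}/4}$, where $t=\sqrt{n}\left(\frac{1}{4d^{2}}-\frac{2}{n}\right)$.
   Context: The degree of $f\colon\{-1,1\}^n\to\mathbb{R}$ is the degree of its unique multilinear polynomial representation. $f$ is symmetric if $f(\mathbf{x})$ depends only on $x_1+\cdots+x_n$. With $x\oplus e_i$ the point $x$ with $i$th coordinate flipped, $\mathrm{Inf}[f]=\sum_{i=1}^n\mathbb{E}_x\left|\frac{f(x)-f(x\oplus e_i)}{2}\right|$, $x$ uniform on $\{-1,1\}^n$. *)

theory Defs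
  imports "HOL-Probability.Probability"
begin

text \<open>
  The dimension is a natural number rather than a type, so that a constant can be chosen
  before it.
\<close>

definition cube :: "nat \<Rightarrow> (nat \<Rightarrow> real) set" where
  "cube n = {1..n} \<rightarrow>\<^sub>E {-1, 1}"

text \<open>
  A multilinear polynomial in \<open>x\<^sub>1, \<dots>, x\<^sub>n\<close> is given by its coefficients, indexed by the
  subsets of \<open>{1..n}\<close>: the coefficient at \<open>S\<close> belongs to the monomial \<open>\<Prod>i\<in>S. x\<^sub>i\<close>.
\<close>

definition multilinear_rep :: "nat \<Rightarrow> ((nat \<Rightarrow> real) \<Rightarrow> real) \<Rightarrow> (nat set \<Rightarrow> real) \<Rightarrow> bool" where
  "multilinear_rep n f c \<longleftrightarrow>
     (\<forall>S. \<not> S \<subseteq> {1..n} \<longrightarrow> c S = 0) \<and>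
     (\<forall>x\<in>cube n. f x = (\<Sum>S\<in>Pow {1..n}. c S * (\<Prod>i\<in>S. x i)))"

definition multilinear_coeff :: "nat \<Rightarrow> ((nat \<Rightarrow> real) \<Rightarrow> real) \<Rightarrow> nat set \<Rightarrow> real" where
  "multilinear_coeff n f = (THE c. multilinear_rep n f c)"

text \<open>The zero function gets degree 0.\<close>

definition cube_degree :: "nat \<Rightarrow> ((nat \<Rightarrow> real) \<Rightarrow> real) \<Rightarrow> nat" where
  "cube_degree n f =
     Max (insert 0 (card ` {S. S \<subseteq> {1..n} \<and> multilinear_coeff n f S \<noteq> 0}))"

definition cube_symmetric :: "nat \<Rightarrow> ((nat \<Rightarrow> real) \<Rightarrow> real) \<Rightarrow> bool" where
  "cube_symmetric n f \<longleftrightarrow>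
     (\<forall>x\<in>cube n. \<forall>y\<in>cube n. (\<Sum>i=1..n. x i) = (\<Sum>i=1..n. y i) \<longrightarrow> f x = f y)"

definition total_influence :: "nat \<Rightarrow> ((nat \<Rightarrow> real) \<Rightarrow> real) \<Rightarrow> real" where
  "total_influence n f =
     (\<Sum>i=1..n. measure_pmf.expectation (pmf_of_set (cube n))
        (\<lambda>x. \<bar>(f x - f (x(i := - x i))) / 2\<bar>))"

lemma finite_cube [simp]: "finite (cube n)"
  by (auto simp: cube_def intro: finite_PiE)

lemma sum_cube_prod_mult:
  assumes "S \<subseteq> {1..n}" "T \<subseteq> {1..n}"
  shows "(\<Sum>x\<in>cube n. (\<Prod>i\<in>S. x i) * (\<Prod>i\<in>T. x i)) = (if S = T then 2 ^ n else 0)"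
proof -
  let ?g = "\<lambda>i (y::real). (if i \<in> S then y else 1) * (if i \<in> T then y else 1)"
  have *: "(\<Prod>i\<in>U. x i) = (\<Prod>i=1..n. if i \<in> U then x i else 1)"
    if "U \<subseteq> {1..n}" for U and x :: "nat \<Rightarrow> real"
    using that by (simp add: prod.inter_restrict[symmetric] Int_absorb1)
  have "(\<Sum>x\<in>cube n. (\<Prod>i\<in>S. x i) * (\<Prod>i\<in>T. x i)) = (\<Sum>x\<in>cube n. \<Prod>i=1..n. ?g i (x i))"
    by (simp add: *[OF assms(1)] *[OF assms(2)] prod.distrib)
  also have "\<dots> = (\<Prod>i=1..n. \<Sum>y\<in>{-1, 1}. ?g i y)"
    unfolding cube_def by (rule prod_sum_PiE[symmetric]) auto
  also have "\<dots> = (\<Prod>i=1..n. if i \<in> S \<longleftrightarrow> i \<in> T then 2 else 0)"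
    by (intro prod.cong) auto
  also have "\<dots> = (if S = T then 2 ^ n else 0)"
  proof (cases "S = T")
    case False
    then obtain i where "i \<in> {1..n}" "\<not> (i \<in> S \<longleftrightarrow> i \<in> T)" using assms by blast
    then show ?thesis using False by (auto intro!: prod_zero)
  qed simp
  finally show ?thesis .
qed

lemma sum_Pow_prod_mult:
  assumes "x \<in> cube n" "y \<in> cube n"
  shows "(\<Sum>S\<in>Pow {1..n}. (\<Prod>i\<in>S. x i) * (\<Prod>i\<in>S. y i)) = (if x = y then 2 ^ n else 0)"
proof -
  have "(\<Sum>S\<in>Pow {1..n}. (\<Prod>i\<in>S. x i) * (\<Prod>i\<in>S. y i)) = (\<Prod>i=1..n. x i * y i + 1)"
    by (subst prod_add) (simp_all add: prod.distrib)
  also have "\<dots> = (\<Prod>i=1..n. if x i = y i then 2 else 0)"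
  proof (rule prod.cong[OF refl])
    fix i assume "i \<in> {1..n}"
    then have "x i \<in> {-1, 1}" "y i \<in> {-1, 1}"
      using assms unfolding cube_def by blast+
    then show "x i * y i + 1 = (if x i = y i then 2 else 0)" by auto
  qed
  also have "\<dots> = (if x = y then 2 ^ n else 0)"
  proof (cases "x = y")
    case False
    then obtain i where "i \<in> {1..n}" "x i \<noteq> y i"
      using assms unfolding cube_def by (meson PiE_ext)
    then show ?thesis using False by (auto intro!: prod_zero)
  qed simp
  finally show ?thesis .
qed

lemma multilinear_rep_ex1: "\<exists>!c. multilinear_rep n f c"
proof (rule ex_ex1I)
  let ?c = "\<lambda>S. if S \<subseteq> {1..n} then (\<Sum>y\<in>cube n. f y * (\<Prod>i\<in>S. y i)) / 2 ^ n else 0"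
  have "f x = (\<Sum>S\<in>Pow {1..n}. ?c S * (\<Prod>i\<in>S. x i))" if x: "x \<in> cube n" for x
  proof -
    have "(\<Sum>S\<in>Pow {1..n}. ?c S * (\<Prod>i\<in>S. x i)) =
      (\<Sum>S\<in>Pow {1..n}. \<Sum>y\<in>cube n. f y / 2 ^ n * ((\<Prod>i\<in>S. y i) * (\<Prod>i\<in>S. x i)))"
      by (intro sum.cong) (auto simp: sum_distrib_right sum_divide_distrib mult.assoc)
    also have "\<dots> = (\<Sum>y\<in>cube n. f y / 2 ^ n *
        (\<Sum>S\<in>Pow {1..n}. (\<Prod>i\<in>S. y i) * (\<Prod>i\<in>S. x i)))"
      by (subst sum.swap) (simp add: sum_distrib_left)
    also have "\<dots> = (\<Sum>y\<in>cube n. if y = x then f y else 0)"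
      by (intro sum.cong refl) (simp add: sum_Pow_prod_mult x del: One_nat_def)
    also have "\<dots> = f x" using x by simp
    finally show ?thesis by simp
  qed
  then show "\<exists>c. multilinear_rep n f c"
    unfolding multilinear_rep_def by (intro exI[of _ ?c]) auto
next
  have *: "c T = (\<Sum>x\<in>cube n. f x * (\<Prod>i\<in>T. x i)) / 2 ^ n"
    if c: "multilinear_rep n f c" and T: "T \<subseteq> {1..n}" for c T
  proof -
    have "(\<Sum>x\<in>cube n. f x * (\<Prod>i\<in>T. x i)) =
      (\<Sum>x\<in>cube n. \<Sum>S\<in>Pow {1..n}. c S * ((\<Prod>i\<in>S. x i) * (\<Prod>i\<in>T. x i)))"
      using c by (intro sum.cong) (auto simp: multilinear_rep_def sum_distrib_right mult.assoc)
    also have "\<dots> = (\<Sum>S\<in>Pow {1..n}. c S * (\<Sum>x\<in>cube n. (\<Prod>i\<in>S. x i) * (\<Prod>i\<in>T. x i)))"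
      by (subst sum.swap) (simp add: sum_distrib_left)
    also have "\<dots> = (\<Sum>S\<in>Pow {1..n}. if S = T then c S * 2 ^ n else 0)"
      by (intro sum.cong refl) (use T in \<open>simp add: sum_cube_prod_mult del: One_nat_def\<close>)
    also have "\<dots> = c T * 2 ^ n" using T by simp
    finally show ?thesis by simp
  qed
  fix c c' assume c: "multilinear_rep n f c" "multilinear_rep n f c'"
  show "c = c'"
  proof
    fix T show "c T = c' T"
    proof (cases "T \<subseteq> {1..n}")
      case True
      show ?thesis by (simp only: *[OF c(1) True] *[OF c(2) True])
    next
      case False
      then show ?thesis using c by (simp add: multilinear_rep_def)
    qed
  qed
qed

end

theory Submission
  imports Defs
begin

text \<open>
  A symmetric \<open>f\<close> of degree \<open>d\<close> has the form \<open>f x = P ((\<Sum>\<^sub>i x\<^sub>i) / n)\<close> with \<open>degree P \<le> d\<close>, and \<open>P\<close> is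
  bounded on \<open>[-1, 1]\<close> because it is bounded on a grid much finer than \<open>1 / d\<^sup>2\<close>. Bernstein's inequality
  then bounds \<open>P''\<close> near \<open>0\<close> by a multiple of \<open>d\<^sup>2\<close>, so on the window \<open>\<bar>u\<bar> \<le> 1 / (4 d\<^sup>2)\<close> either
  \<open>P'\<close> has constant sign or \<open>\<bar>P'\<bar> \<le> d\<close>. In the second case the window contributes at most \<open>d\<close> to the
  influence. In the first case absolute values may be dropped there, and up to the tail the influence is
  \<open>\<bar>\<Sum>\<^sub>i c\<^sub>i\<bar>\<close> with \<open>c\<^sub>i\<close> the degree-one coefficients; this is the derivative at \<open>0\<close> of the multilinear
  extension on the diagonal, hence at most \<open>d\<close> by Bernstein's inequality. The points outside the window
  have measure at most \<open>2 e\<^bsup>-t\<^sup>2/2\<^esup>\<close> by Hoeffding's bound, and as \<open>\<Sum>\<^sub>i E (D\<^sub>i f)\<^sup>2 \<le> d\<close>, Cauchy--Schwarz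
  shows that they contribute \<open>O (\<surd>(d n) e\<^bsup>-t\<^sup>2/4\<^esup>)\<close>.
\<close>

section \<open>Riesz interpolation and Bernstein's inequality\<close>

definition riesz_node :: "nat \<Rightarrow> nat \<Rightarrow> real" where
  "riesz_node N k = (2 * real k + 1) * pi / (2 * real N)"

definition riesz_weight :: "nat \<Rightarrow> nat \<Rightarrow> real" where
  "riesz_weight N k = sin (real N * riesz_node N k) / (2 * real N * (1 - cos (riesz_node N k)))"

lemma sum_cos_riesz_node:
  assumes "0 < m" "m < 2 * N"
  shows "(\<Sum>k<2*N. cos (real m * riesz_node N k)) = 0"
proof -
  define \<alpha> where "\<alpha> = real m * pi / (2 * real N)"
  have "0 < \<alpha>" "\<alpha> < pi"
    using assms by (auto simp: \<alpha>_def field_simps)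
  then have sin_pos: "sin \<alpha> > 0" by (rule sin_gt_zero)
  have "2 * sin \<alpha> * cos (real m * riesz_node N k) =
    sin (2 * real (Suc k) * \<alpha>) - sin (2 * real k * \<alpha>)" for k
  proof -
    have "sin (2 * real (Suc k) * \<alpha>) = sin ((2 * real k + 1) * \<alpha> + \<alpha>)"
      "sin (2 * real k * \<alpha>) = sin ((2 * real k + 1) * \<alpha> - \<alpha>)"
      by (simp_all add: algebra_simps)
    moreover have "real m * riesz_node N k = (2 * real k + 1) * \<alpha>"
      by (simp add: riesz_node_def \<alpha>_def)
    ultimately show ?thesis by (simp only: sin_add sin_diff) simp
  qed
  then have "2 * sin \<alpha> * (\<Sum>k<2*N. cos (real m * riesz_node N k))
      = (\<Sum>k<2*N. sin (2 * real (Suc k) * \<alpha>) - sin (2 * real k * \<alpha>))"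
    by (simp only: sum_distrib_left)
  also have "\<dots> = sin (2 * real (2 * N) * \<alpha>)"
    by (subst sum_lessThan_telescope) simp
  also have "2 * real (2 * N) * \<alpha> = real (2 * m) * pi"
    using assms by (simp add: \<alpha>_def)
  finally show ?thesis using sin_pos by simp
qed

lemma cos_degree_mult_riesz_node: "cos (real N * riesz_node N k) = 0" if "N > 0"
proof -
  have "real N * riesz_node N k = real k * pi + pi / 2"
    using that by (simp add: riesz_node_def field_simps)
  then show ?thesis by (simp add: cos_add)
qed

lemma sin_degree_mult_riesz_node_sq: "(sin (real N * riesz_node N k))\<^sup>2 = 1" if "N > 0"
  by (simp add: sin_squared_eq cos_degree_mult_riesz_node that)

lemma cos_riesz_node_less_1:
  assumes "k < 2 * N"
  shows "cos (riesz_node N k) < 1"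
proof -
  have "2 * real k + 1 < 4 * real N"
    using assms by linarith
  then have "(2 * real k + 1) * pi < 4 * real N * pi"
    by (rule mult_strict_right_mono) simp
  then have "0 < riesz_node N k / 2" "riesz_node N k / 2 < pi"
    using assms by (auto simp: riesz_node_def field_simps intro!: add_pos_nonneg)
  then have "sin (riesz_node N k / 2) > 0" by (rule sin_gt_zero)
  then have "(sin (riesz_node N k / 2))\<^sup>2 > 0" by simp
  then show ?thesis
    using cos_double_sin[of "riesz_node N k / 2"] by simp
qed

lemma riesz_weight_mult:
  assumes "k < 2 * N"
  shows "riesz_weight N k * (1 - cos (riesz_node N k)) = sin (real N * riesz_node N k) / (2 * real N)"
  using cos_riesz_node_less_1[OF assms] by (simp add: riesz_weight_def)

lemma riesz_weight_second_difference:
  assumes "k < 2 * N"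
  shows "riesz_weight N k * (2 * sin x - sin (x + riesz_node N k) - sin (x - riesz_node N k)) =
    sin (real N * riesz_node N k) * sin x / real N"
proof -
  have "2 * sin x - sin (x + riesz_node N k) - sin (x - riesz_node N k) =
    (1 - cos (riesz_node N k)) * (2 * sin x)"
    by (simp add: sin_add sin_diff algebra_simps)
  then show ?thesis
    by (simp only: mult.assoc[symmetric] riesz_weight_mult[OF assms]) simp
qed

lemma sum_riesz_weight_cos:
  "(\<Sum>k<2*N. riesz_weight N k * cos (of_int j * riesz_node N k)) = 0" (is "?S = 0")
proof -
  have node_reflect: "riesz_node N (2 * N - Suc k) = 2 * pi - riesz_node N k" if "k < 2 * N" for k
    using that by (simp add: riesz_node_def of_nat_diff field_simps)
  have cos_reflect: "cos (of_int m * (2 * pi - y)) = cos (of_int m * y)"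
    and sin_reflect: "sin (of_int m * (2 * pi - y)) = - sin (of_int m * y)" for m :: int and y
    using sin_int_2pin[of m] cos_int_2pin[of m]
    by (simp_all add: right_diff_distrib cos_diff sin_diff mult_ac)
  have weight_reflect: "riesz_weight N (2 * N - Suc k) = - riesz_weight N k" if "k < 2 * N" for k
    using sin_reflect[of "int N" "riesz_node N k"] cos_reflect[of 1 "riesz_node N k"]
    by (simp add: riesz_weight_def node_reflect[OF that])
  have "?S = (\<Sum>k<2*N. riesz_weight N (2 * N - Suc k) * cos (of_int j * riesz_node N (2 * N - Suc k)))"
    by (rule sum.nat_diff_reindex[symmetric])
  also have "\<dots> = (\<Sum>k<2*N. - (riesz_weight N k * cos (of_int j * riesz_node N k)))"
    by (intro sum.cong refl) (simp add: node_reflect weight_reflect cos_reflect)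
  also have "\<dots> = - ?S" by (simp add: sum_negf)
  finally show ?thesis by simp
qed

lemma sum_sin_mult_sin_riesz_node:
  assumes "0 < j" "j < N"
  shows "(\<Sum>k<2*N. sin (real N * riesz_node N k) * sin (real j * riesz_node N k)) = 0"
proof -
  have "sin (real N * y) * sin (real j * y) =
    (cos (real (N - j) * y) - cos (real (N + j) * y)) / 2" for y
    using assms by (simp add: sin_times_sin of_nat_diff algebra_simps)
  then have "(\<Sum>k<2*N. sin (real N * riesz_node N k) * sin (real j * riesz_node N k)) =
    ((\<Sum>k<2*N. cos (real (N - j) * riesz_node N k)) - (\<Sum>k<2*N. cos (real (N + j) * riesz_node N k))) / 2"
    by (simp only: sum_divide_distrib[symmetric] sum_subtractf)
  then show ?thesis
    using assms sum_cos_riesz_node[of "N - j" N] sum_cos_riesz_node[of "N + j" N] by simp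
qed

lemma sum_riesz_weight_second_difference:
  assumes "Suc j < N"
  shows "(\<Sum>k<2*N. riesz_weight N k *
      (sin (real (Suc j) * riesz_node N k) - sin (real j * riesz_node N k))) =
    (\<Sum>k<2*N. riesz_weight N k *
      (sin (real (Suc (Suc j)) * riesz_node N k) - sin (real (Suc j) * riesz_node N k)))"
    (is "(\<Sum>k<2*N. ?\<Delta> k) = (\<Sum>k<2*N. ?\<Delta>' k)")
proof -
  have "?\<Delta> k - ?\<Delta>' k = sin (real N * riesz_node N k) * sin (real (Suc j) * riesz_node N k) / real N"
    if "k < 2 * N" for k
    using riesz_weight_second_difference[OF that, of "real (Suc j) * riesz_node N k"]
    by (simp add: algebra_simps)
  then have "(\<Sum>k<2*N. ?\<Delta> k - ?\<Delta>' k) =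
    (\<Sum>k<2*N. sin (real N * riesz_node N k) * sin (real (Suc j) * riesz_node N k) / real N)"
    by (intro sum.cong refl) simp
  also have "\<dots> = 0"
    using sum_sin_mult_sin_riesz_node[of "Suc j" N] assms
    by (simp add: sum_divide_distrib[symmetric] del: of_nat_Suc)
  finally show ?thesis by (simp add: sum_subtractf)
qed

lemma riesz_weight_last_difference:
  assumes "k < 2 * N"
  shows "riesz_weight N k * (sin (real N * riesz_node N k) - sin (real (N - 1) * riesz_node N k)) =
    1 / (2 * real N)"
proof -
  let ?\<theta> = "riesz_node N k"
  have "N > 0" using assms by simp
  then have "sin (real N * ?\<theta> + ?\<theta>) = sin (real N * ?\<theta> - ?\<theta>)"
    by (simp add: sin_add sin_diff cos_degree_mult_riesz_node)
  moreover have "real (N - 1) * ?\<theta> = real N * ?\<theta> - ?\<theta>"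
    using \<open>N > 0\<close> by (simp add: of_nat_diff algebra_simps)
  ultimately show ?thesis
    using riesz_weight_second_difference[OF assms, of "real N * ?\<theta>"]
      sin_degree_mult_riesz_node_sq[OF \<open>N > 0\<close>, of k] \<open>N > 0\<close>
    by (simp add: power2_eq_square field_simps)
qed

text \<open>The vanishing second differences make the sum linear in \<open>j\<close> on \<open>{0..N}\<close>; its slope is read
  off at \<open>j = N\<close>, where \<open>cos (N \<theta>\<^sub>k) = 0\<close>.\<close>

lemma sum_riesz_weight_sin_difference:
  assumes "j < N"
  shows "(\<Sum>k<2*N. riesz_weight N k *
    (sin (real (Suc j) * riesz_node N k) - sin (real j * riesz_node N k))) = 1"
proof -
  have "j \<le> N - 1" using assms by simp
  then show ?thesis
  proof (induction j rule: inc_induct)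
    case base
    show ?case using assms riesz_weight_last_difference[of _ N] by simp
  next
    case (step j)
    then show ?case using sum_riesz_weight_second_difference[of j N] by simp
  qed
qed

lemma sum_riesz_weight_sin:
  assumes "\<bar>j\<bar> \<le> int N"
  shows "(\<Sum>k<2*N. riesz_weight N k * sin (of_int j * riesz_node N k)) = of_int j"
proof -
  have sum_nat: "m \<le> N \<Longrightarrow> (\<Sum>k<2*N. riesz_weight N k * sin (real m * riesz_node N k)) = real m" for m
  proof (induction m)
    case (Suc m)
    then show ?case
      using sum_riesz_weight_sin_difference[of m N] by (simp add: right_diff_distrib sum_subtractf)
  qed simp
  show ?thesis
  proof (cases j)
    case (nonneg m)
    then show ?thesis using sum_nat[of m] assms by simp
  next
    case (neg m)
    then have "real_of_int j = - real (Suc m)" by simp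
    then show ?thesis
      using sum_nat[of "Suc m"] assms neg by (simp add: sum_negf del: of_nat_Suc)
  qed
qed

lemma sum_abs_riesz_weight: "(\<Sum>k<2*N. \<bar>riesz_weight N k\<bar>) = real N"
proof -
  have "(\<Sum>k<2*N. \<bar>riesz_weight N k\<bar>) =
    (\<Sum>k<2*N. riesz_weight N k * sin (of_int (int N) * riesz_node N k))"
  proof (rule sum.cong[OF refl])
    fix k assume "k \<in> {..<2*N}"
    then have "0 < N" "cos (riesz_node N k) < 1" using cos_riesz_node_less_1 by auto
    then have "2 * real N * (1 - cos (riesz_node N k)) > 0" by simp
    moreover have "sin (real N * riesz_node N k) = 1 \<or> sin (real N * riesz_node N k) = -1"
      using sin_degree_mult_riesz_node_sq[OF \<open>0 < N\<close>, of k] by (simp add: power2_eq_1_iff)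
    ultimately show "\<bar>riesz_weight N k\<bar> = riesz_weight N k * sin (of_int (int N) * riesz_node N k)"
      by (auto simp: riesz_weight_def abs_div)
  qed
  then show ?thesis using sum_riesz_weight_sin[of "int N" N] by simp
qed

inductive trig_poly :: "nat \<Rightarrow> (real \<Rightarrow> real) \<Rightarrow> bool" for N where
  trig_poly_wave: "\<bar>j\<bar> \<le> int N \<Longrightarrow> trig_poly N (\<lambda>y. cos (of_int j * y + \<phi>))"
| trig_poly_add: "trig_poly N S \<Longrightarrow> trig_poly N T \<Longrightarrow> trig_poly N (\<lambda>y. S y + T y)"
| trig_poly_cmult: "trig_poly N T \<Longrightarrow> trig_poly N (\<lambda>y. c * T y)"

lemma trig_poly_mono: "trig_poly N T \<Longrightarrow> N \<le> M \<Longrightarrow> trig_poly M T"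
  by (induction rule: trig_poly.induct) (auto intro: trig_poly.intros)

lemma trig_poly_const: "trig_poly N (\<lambda>y. c)"
  using trig_poly_cmult[OF trig_poly_wave[of 0 N 0], of c] by simp

lemma trig_poly_cos: "trig_poly 1 cos"
  using trig_poly_wave[of 1 1 0] by simp

lemma trig_poly_sum: "(\<And>i. i \<in> I \<Longrightarrow> trig_poly N (T i)) \<Longrightarrow> trig_poly N (\<lambda>y. \<Sum>i\<in>I. T i y)"
  by (induction I rule: infinite_finite_induct) (simp_all add: trig_poly_const trig_poly_add)

lemma trig_poly_shift: "trig_poly N T \<Longrightarrow> trig_poly N (\<lambda>y. T (y + h))"
proof (induction rule: trig_poly.induct)
  case (trig_poly_wave j \<phi>)
  then show ?case
    using trig_poly.trig_poly_wave[of j N "of_int j * h + \<phi>"] by (simp add: algebra_simps)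
qed (auto intro: trig_poly.intros)

lemma trig_poly_mult: "trig_poly N S \<Longrightarrow> trig_poly M T \<Longrightarrow> trig_poly (N + M) (\<lambda>y. S y * T y)"
proof (induction rule: trig_poly.induct)
  case (trig_poly_wave j \<phi>)
  from trig_poly_wave(2) show ?case
  proof (induction rule: trig_poly.induct)
    case (trig_poly_wave k \<psi>)
    have "cos (of_int j * y + \<phi>) * cos (of_int k * y + \<psi>) =
      (1/2) * cos (of_int (j - k) * y + (\<phi> - \<psi>)) + (1/2) * cos (of_int (j + k) * y + (\<phi> + \<psi>))" for y
      by (simp add: cos_times_cos algebra_simps)
    moreover have "\<bar>j - k\<bar> \<le> int (N + M)" "\<bar>j + k\<bar> \<le> int (N + M)"
      using \<open>\<bar>j\<bar> \<le> int N\<close> trig_poly_wave by auto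
    ultimately show ?case by (simp only: trig_poly.intros)
  next
    case (trig_poly_add S T)
    then show ?case by (simp add: distrib_left trig_poly.trig_poly_add)
  next
    case (trig_poly_cmult T c)
    then show ?case by (simp add: mult.left_commute trig_poly.trig_poly_cmult)
  qed
next
  case (trig_poly_add S S')
  then show ?case by (simp add: distrib_right trig_poly.trig_poly_add)
next
  case (trig_poly_cmult S c)
  then show ?case by (simp add: mult.assoc trig_poly.trig_poly_cmult)
qed

lemma trig_poly_poly: "trig_poly N T \<Longrightarrow> trig_poly (degree p * N) (\<lambda>y. poly p (T y))"
proof (induction p)
  case 0
  then show ?case by (simp add: trig_poly_const)
next
  case (pCons a p)
  show ?case
  proof (cases "p = 0")
    case True
    then show ?thesis by (simp add: trig_poly_const)
  next
    case False
    have "trig_poly (N + degree p * N) (\<lambda>y. a + T y * poly p (T y))"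
      by (intro trig_poly_add trig_poly_const trig_poly_mult pCons)
    with False show ?thesis by simp
  qed
qed

lemma trig_poly_poly_cos: "degree p \<le> N \<Longrightarrow> trig_poly N (\<lambda>y. poly p (cos y))"
  using trig_poly_poly[OF trig_poly_cos, of p] by (auto intro: trig_poly_mono)

definition riesz_deriv :: "nat \<Rightarrow> (real \<Rightarrow> real) \<Rightarrow> real \<Rightarrow> real" where
  "riesz_deriv N T y = (\<Sum>k<2*N. riesz_weight N k * T (y + riesz_node N k))"

lemma trig_poly_riesz_deriv: "trig_poly N T \<Longrightarrow> trig_poly N (riesz_deriv N T)"
  unfolding riesz_deriv_def[abs_def] by (intro trig_poly_sum trig_poly_cmult trig_poly_shift)

lemma riesz_interpolation: "trig_poly N T \<Longrightarrow> (T has_real_derivative riesz_deriv N T y) (at y)"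
proof (induction rule: trig_poly.induct)
  case (trig_poly_wave j \<phi>)
  let ?a = "of_int j * y + \<phi>"
  have "riesz_deriv N (\<lambda>y. cos (of_int j * y + \<phi>)) y =
    (\<Sum>k<2*N. riesz_weight N k * cos (?a + of_int j * riesz_node N k))"
    by (simp add: riesz_deriv_def algebra_simps)
  also have "\<dots> = cos ?a * (\<Sum>k<2*N. riesz_weight N k * cos (of_int j * riesz_node N k)) -
    sin ?a * (\<Sum>k<2*N. riesz_weight N k * sin (of_int j * riesz_node N k))"
    by (simp add: cos_add sum_distrib_left sum_subtractf right_diff_distrib mult_ac)
  also have "\<dots> = - (sin ?a * of_int j)"
    by (simp add: sum_riesz_weight_cos sum_riesz_weight_sin[OF trig_poly_wave])
  finally show ?case
    by (auto intro!: derivative_eq_intros)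
next
  case (trig_poly_add S T)
  then show ?case
    using DERIV_add[OF trig_poly_add.IH] by (simp add: riesz_deriv_def distrib_left sum.distrib)
next
  case (trig_poly_cmult T c)
  then show ?case
    using DERIV_cmult[OF trig_poly_cmult.IH, of c]
    by (simp add: riesz_deriv_def sum_distrib_left mult_ac)
qed

lemma abs_riesz_deriv_le:
  assumes "\<And>y. \<bar>T y\<bar> \<le> M"
  shows "\<bar>riesz_deriv N T y\<bar> \<le> real N * M"
proof -
  have "\<bar>riesz_deriv N T y\<bar> \<le> (\<Sum>k<2*N. \<bar>riesz_weight N k * T (y + riesz_node N k)\<bar>)"
    unfolding riesz_deriv_def by (rule sum_abs)
  also have "\<dots> \<le> (\<Sum>k<2*N. \<bar>riesz_weight N k\<bar> * M)"
    unfolding abs_mult by (intro sum_mono mult_left_mono assms) simp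
  also have "\<dots> = real N * M"
    by (simp add: sum_abs_riesz_weight flip: sum_distrib_right)
  finally show ?thesis .
qed

lemma trig_poly_derivative:
  assumes "trig_poly N T" "\<And>y. (T has_real_derivative T' y) (at y)"
  shows "trig_poly N T'"
proof -
  have "T' = riesz_deriv N T"
    using DERIV_unique[OF assms(2) riesz_interpolation[OF assms(1)]] by blast
  with assms(1) show ?thesis by (simp add: trig_poly_riesz_deriv)
qed

theorem trig_poly_bernstein:
  assumes "trig_poly N T" "(T has_real_derivative D) (at y)" "\<And>y. \<bar>T y\<bar> \<le> M"
  shows "\<bar>D\<bar> \<le> real N * M"
  using DERIV_unique[OF assms(2) riesz_interpolation[OF assms(1)]]
    abs_riesz_deriv_le[of T M N y] assms(3)
  by simp

lemma
  fixes p :: "real poly"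
  assumes deg: "degree p \<le> N" and bound: "\<And>u. \<bar>u\<bar> \<le> 1 \<Longrightarrow> \<bar>poly p u\<bar> \<le> M" and u: "\<bar>u\<bar> \<le> 1"
  shows poly_bernstein_first: "\<bar>poly (pderiv p) u\<bar> * sqrt (1 - u\<^sup>2) \<le> real N * M"
    and poly_bernstein_second:
      "\<bar>poly (pderiv (pderiv p)) u * (1 - u\<^sup>2) - poly (pderiv p) u * u\<bar> \<le> (real N)\<^sup>2 * M"
proof -
  define T where "T y = poly p (cos y)" for y
  define T' where "T' y = - (poly (pderiv p) (cos y) * sin y)" for y
  define T'' where
    "T'' y = poly (pderiv (pderiv p)) (cos y) * (sin y)\<^sup>2 - poly (pderiv p) (cos y) * cos y" for y
  have T: "trig_poly N T"
    unfolding T_def[abs_def] by (rule trig_poly_poly_cos[OF deg])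
  have T_deriv: "(T has_real_derivative T' y) (at y)" for y
    unfolding T_def[abs_def] T'_def by (auto intro!: derivative_eq_intros)
  have T'_deriv: "(T' has_real_derivative T'' y) (at y)" for y
    unfolding T'_def[abs_def] T''_def by (auto intro!: derivative_eq_intros simp: power2_eq_square)
  have T'_le: "\<bar>T' y\<bar> \<le> real N * M" for y
    by (rule trig_poly_bernstein[OF T T_deriv]) (simp add: T_def bound)
  have T''_le: "\<bar>T'' y\<bar> \<le> real N * (real N * M)" for y
    by (rule trig_poly_bernstein[OF trig_poly_derivative[OF T T_deriv] T'_deriv T'_le])
  have trig: "cos (arccos u) = u" "sin (arccos u) = sqrt (1 - u\<^sup>2)" and "u\<^sup>2 \<le> 1"
    using u by (auto simp: cos_arccos_abs sin_arccos_abs abs_square_le_1)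
  show "\<bar>poly (pderiv p) u\<bar> * sqrt (1 - u\<^sup>2) \<le> real N * M"
    using T'_le[of "arccos u"] \<open>u\<^sup>2 \<le> 1\<close> by (simp add: T'_def trig abs_mult)
  show "\<bar>poly (pderiv (pderiv p)) u * (1 - u\<^sup>2) - poly (pderiv p) u * u\<bar> \<le> (real N)\<^sup>2 * M"
    using T''_le[of "arccos u"] \<open>u\<^sup>2 \<le> 1\<close>
    by (simp add: T''_def trig power2_eq_square[of "real N"] mult.assoc)
qed

lemma abs_poly_pderiv2_le_near_0:
  fixes p :: "real poly"
  assumes deg: "degree p \<le> d" and bound: "\<And>u. \<bar>u\<bar> \<le> 1 \<Longrightarrow> \<bar>poly p u\<bar> \<le> M" and u: "\<bar>u\<bar> \<le> 1 / 4"
  shows "\<bar>poly (pderiv (pderiv p)) u\<bar> \<le> 3 / 2 * (real d)\<^sup>2 * M"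
proof -
  let ?p' = "poly (pderiv p) u" and ?p'' = "poly (pderiv (pderiv p)) u"
  have u1: "\<bar>u\<bar> \<le> 1" using u by simp
  have "M \<ge> 0" using bound[of 0] by linarith
  have "u\<^sup>2 \<le> (1 / 4)\<^sup>2" using u by (metis abs_ge_zero power2_abs power_mono)
  then have sq: "15 / 16 \<le> 1 - u\<^sup>2" by (simp add: power2_eq_square)
  have "15 / 16 \<le> sqrt (1 - u\<^sup>2)"
    by (rule real_le_rsqrt) (use sq in \<open>simp add: power2_eq_square\<close>)
  then have "\<bar>?p'\<bar> * (15 / 16) \<le> \<bar>?p'\<bar> * sqrt (1 - u\<^sup>2)"
    by (rule mult_left_mono) simp
  also have "\<dots> \<le> real d * M" by (rule poly_bernstein_first[OF deg bound u1])
  also have "\<dots> \<le> (real d)\<^sup>2 * M"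
    using \<open>M \<ge> 0\<close> by (intro mult_right_mono) (cases d, auto simp: power2_eq_square)
  finally have first: "\<bar>?p'\<bar> * (15 / 16) \<le> (real d)\<^sup>2 * M" .
  have "\<bar>?p' * u\<bar> \<le> \<bar>?p'\<bar> * (1 / 4)"
    unfolding abs_mult by (intro mult_left_mono u) simp
  moreover have "\<bar>?p''\<bar> * (15 / 16) \<le> \<bar>?p'' * (1 - u\<^sup>2)\<bar>"
    unfolding abs_mult by (intro mult_left_mono) (use sq in auto)
  ultimately show ?thesis
    using first poly_bernstein_second[OF deg bound u1] \<open>M \<ge> 0\<close> by linarith
qed

lemma abs_poly_pderiv_diff_le_near_0:
  fixes p :: "real poly"
  assumes deg: "degree p \<le> d" and bound: "\<And>u. \<bar>u\<bar> \<le> 1 \<Longrightarrow> \<bar>poly p u\<bar> \<le> M"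
    and a: "a \<le> 1 / 4" and uv: "\<bar>u\<bar> \<le> a" "\<bar>v\<bar> \<le> a"
  shows "\<bar>poly (pderiv p) u - poly (pderiv p) v\<bar> \<le> 3 * a * (real d)\<^sup>2 * M"
proof -
  let ?K = "3 / 2 * (real d)\<^sup>2 * M"
  have "M \<ge> 0" using bound[of 0] by linarith
  have "norm (poly (pderiv p) u - poly (pderiv p) v) \<le> ?K * norm (u - v)"
  proof (rule field_differentiable_bound[of "{-a..a}"])
    fix w assume "w \<in> {-a..a}"
    then have "\<bar>w\<bar> \<le> 1 / 4" using a by auto
    then show "norm (poly (pderiv (pderiv p)) w) \<le> ?K"
      using abs_poly_pderiv2_le_near_0[OF deg bound] by simp
  qed (use uv in \<open>auto intro: poly_DERIV has_field_derivative_at_within\<close>)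
  also have "\<dots> \<le> ?K * (2 * a)"
    using uv \<open>M \<ge> 0\<close> by (intro mult_left_mono) auto
  finally show ?thesis by (simp add: mult_ac)
qed

lemma pderiv_constant_sign_or_small:
  fixes p :: "real poly"
  assumes deg: "degree p \<le> d" and bound: "\<forall>u. \<bar>u\<bar> \<le> 1 \<longrightarrow> \<bar>poly p u\<bar> \<le> M" and a: "a \<le> 1 / 4"
  obtains (constant_sign) \<epsilon> :: real where "\<bar>\<epsilon>\<bar> = 1" "\<And>u. \<bar>u\<bar> \<le> a \<Longrightarrow> 0 \<le> \<epsilon> * poly (pderiv p) u"
  | (small) "\<And>u. \<bar>u\<bar> \<le> a \<Longrightarrow> \<bar>poly (pderiv p) u\<bar> \<le> 3 * a * (real d)\<^sup>2 * M"
proof -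
  consider (pos) "\<And>u. \<bar>u\<bar> \<le> a \<Longrightarrow> 0 \<le> poly (pderiv p) u"
    | (neg) "\<And>u. \<bar>u\<bar> \<le> a \<Longrightarrow> poly (pderiv p) u \<le> 0"
    | (mixed) v w where "\<bar>v\<bar> \<le> a" "poly (pderiv p) v < 0" "\<bar>w\<bar> \<le> a" "0 < poly (pderiv p) w"
    by (meson not_le)
  then show thesis
  proof cases
    case pos
    then show ?thesis by (intro constant_sign[of 1]) auto
  next
    case neg
    then show ?thesis by (intro constant_sign[of "-1"]) auto
  next
    case mixed
    show ?thesis
    proof (rule small)
      fix u assume "\<bar>u\<bar> \<le> a"
      then show "\<bar>poly (pderiv p) u\<bar> \<le> 3 * a * (real d)\<^sup>2 * M"
        using abs_poly_pderiv_diff_le_near_0[OF deg _ a, of M u v]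
          abs_poly_pderiv_diff_le_near_0[OF deg _ a, of M u w] bound mixed by auto
    qed
  qed
qed

section \<open>Polynomials bounded on a fine grid\<close>

lemma sq_div_8_le_one_minus_cos:
  assumes "\<bar>x\<bar> \<le> pi"
  shows "x\<^sup>2 / 8 \<le> 1 - cos x"
proof -
  define y where "y = \<bar>x\<bar> / 2"
  have y: "0 \<le> y" "y \<le> 1.6" using assms pi_approx by (auto simp: y_def)
  have "\<bar>sin y - y\<bar> \<le> y ^ 3 / 6"
    using Maclaurin_sin_bound[of y 3] y(1) by (simp add: numeral_3_eq_3 sin_coeff_def)
  moreover have "y ^ 3 / 6 \<le> y / 2"
  proof -
    have "y\<^sup>2 \<le> 1.6\<^sup>2" using y by (intro power_mono) auto
    then have "y * y\<^sup>2 \<le> y * 3" using y by (intro mult_left_mono) (auto simp: power2_eq_square)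
    then show ?thesis by (simp add: power2_eq_square power3_eq_cube)
  qed
  ultimately have "y / 2 \<le> sin y" by linarith
  then have "(y / 2)\<^sup>2 \<le> (sin y)\<^sup>2" using y by (intro power_mono) auto
  moreover have "1 - cos x = 2 * (sin y)\<^sup>2"
    using cos_double_sin[of y] by (simp add: y_def)
  ultimately show ?thesis by (simp add: y_def power_divide)
qed

lemma sq_div_8_le_abs_cos_diff:
  assumes "\<alpha> \<in> {0..pi}" "\<beta> \<in> {0..pi}"
  shows "(\<alpha> - \<beta>)\<^sup>2 / 8 \<le> \<bar>cos \<alpha> - cos \<beta>\<bar>"
  using assms
proof (induction \<beta> \<alpha> rule: linorder_wlog)
  case (le \<beta> \<alpha>)
  have "sin ((\<alpha> + \<beta>) / 2) - sin ((\<alpha> - \<beta>) / 2) = 2 * sin (\<beta> / 2) * cos (\<alpha> / 2)"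
    by (subst sin_diff_sin) (simp add: field_simps)
  also have "\<dots> \<ge> 0"
    using le by (intro mult_nonneg_nonneg sin_ge_zero cos_ge_zero) auto
  finally have "sin ((\<alpha> - \<beta>) / 2) \<le> sin ((\<alpha> + \<beta>) / 2)" by simp
  moreover have "0 \<le> sin ((\<alpha> - \<beta>) / 2)" using le by (intro sin_ge_zero) auto
  ultimately have "2 * (sin ((\<alpha> - \<beta>) / 2))\<^sup>2 \<le> 2 * sin ((\<alpha> + \<beta>) / 2) * sin ((\<alpha> - \<beta>) / 2)"
    by (simp add: power2_eq_square mult_right_mono)
  also have "\<dots> = cos \<beta> - cos \<alpha>"
    by (subst cos_diff_cos) (simp add: add.commute)
  also have "2 * (sin ((\<alpha> - \<beta>) / 2))\<^sup>2 = 1 - cos (\<alpha> - \<beta>)"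
    using cos_double_sin[of "(\<alpha> - \<beta>) / 2"] by (simp del: right_diff_distrib_numeral)
  finally show ?case
    using sq_div_8_le_one_minus_cos[of "\<alpha> - \<beta>"] le by (simp add: abs_if)
next
  case (sym \<beta> \<alpha>)
  then show ?case by (simp add: power2_commute abs_minus_commute)
qed

lemma abs_diff_le_at_critical_point:
  fixes f f' f'' :: "real \<Rightarrow> real"
  assumes "\<And>x. (f has_real_derivative f' x) (at x)" "\<And>x. (f' has_real_derivative f'' x) (at x)"
    and "f' c = 0" "\<And>x. \<bar>f'' x\<bar> \<le> K"
  shows "\<bar>f x - f c\<bar> \<le> K * (x - c)\<^sup>2 / 2"
proof (cases "x = c")
  case False
  let ?diff = "\<lambda>m::nat. if m = 0 then f else if m = 1 then f' else f''"
  have "\<exists>t. (if x < c then x < t \<and> t < c else c < t \<and> t < x) \<and>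
    f x = (\<Sum>m<2. ?diff m c / fact m * (x - c) ^ m) + ?diff 2 t / fact 2 * (x - c) ^ 2"
    by (rule Taylor[where a = "min x c" and b = "max x c"])
       (use assms False in \<open>auto simp: less_2_cases_iff\<close>)
  then obtain t where "f x = (\<Sum>m<2. ?diff m c / fact m * (x - c) ^ m) + ?diff 2 t / fact 2 * (x - c) ^ 2"
    by blast
  then have diff: "f x - f c = f'' t * (x - c)\<^sup>2 / 2"
    using assms(3) by (simp add: lessThan_nat_numeral)
  show ?thesis
    unfolding diff by (simp add: abs_mult mult_right_mono assms(4))
qed simp

lemma trig_poly_near_max:
  assumes T: "trig_poly N T" and max: "\<And>y. \<bar>T y\<bar> \<le> \<bar>T \<theta>\<bar>"
  shows "\<bar>T y - T \<theta>\<bar> \<le> (real N)\<^sup>2 * \<bar>T \<theta>\<bar> * (y - \<theta>)\<^sup>2 / 2"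
proof (rule abs_diff_le_at_critical_point)
  let ?T' = "riesz_deriv N T"
  show T_deriv: "(T has_real_derivative ?T' y) (at y)" for y
    by (rule riesz_interpolation[OF T])
  show "(?T' has_real_derivative riesz_deriv N ?T' y) (at y)" for y
    by (rule riesz_interpolation[OF trig_poly_riesz_deriv[OF T]])
  show "?T' \<theta> = 0"
  proof (cases "T \<theta> \<ge> 0")
    case True
    then have "T y \<le> T \<theta>" for y using max[of y] by simp
    then show ?thesis by (intro DERIV_local_max[OF T_deriv, of 1]) auto
  next
    case False
    then have "T \<theta> \<le> T y" for y using max[of y] by simp
    then show ?thesis by (intro DERIV_local_min[OF T_deriv, of 1]) auto
  qed
  have "\<bar>riesz_deriv N ?T' y\<bar> \<le> real N * (real N * \<bar>T \<theta>\<bar>)" for y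
    by (intro abs_riesz_deriv_le max)
  then show "\<bar>riesz_deriv N ?T' y\<bar> \<le> (real N)\<^sup>2 * \<bar>T \<theta>\<bar>" for y
    by (simp add: power2_eq_square mult.assoc)
qed

lemma ex_grid_point_near:
  assumes "n > 0" "\<bar>v\<bar> \<le> 1"
  obtains m where "m \<le> n" "\<bar>(real n - 2 * real m) / real n - v\<bar> \<le> 1 / real n"
proof -
  define w where "w = (1 - v) * real n / 2"
  have "(1 - v) * real n \<le> 2 * real n" using assms by (intro mult_right_mono) auto
  then have w: "0 \<le> w" "w \<le> real n" using assms by (auto simp: w_def)
  have "0 \<le> round w" "round w \<le> int n" using round_mono[OF w(1)] round_mono[OF w(2)] by auto
  then have m: "nat (round w) \<le> n" "\<bar>real (nat (round w)) - w\<bar> \<le> 1 / 2"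
    using of_int_round_abs_le[of w] by auto
  have "(real n - 2 * real (nat (round w))) / real n - v = - 2 * (real (nat (round w)) - w) / real n"
    using assms(1) by (simp add: w_def field_simps)
  also have "\<bar>\<dots>\<bar> = 2 * \<bar>real (nat (round w)) - w\<bar> / real n"
    by (simp only: abs_divide abs_mult abs_neg_numeral abs_numeral abs_of_nat)
  also have "\<dots> \<le> 1 / real n"
    using m(2) by (intro divide_right_mono) auto
  finally show ?thesis using that m(1) by blast
qed

text \<open>At a maximum of \<open>\<bar>p (cos y)\<bar>\<close> the derivative in \<open>y\<close> vanishes, so by Bernstein's inequality for
  the second derivative the value there differs little from that at the nearest grid point.\<close>

lemma abs_poly_le_of_grid:
  fixes p :: "real poly"
  assumes deg: "degree p \<le> d" and n: "n > 0" "16 * (real d)\<^sup>2 \<le> real n"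
    and grid: "\<And>m. m \<le> n \<Longrightarrow> \<bar>poly p ((real n - 2 * real m) / real n)\<bar> \<le> M"
    and u: "\<bar>u\<bar> \<le> 1"
  shows "\<bar>poly p u\<bar> \<le> 2 * M"
proof -
  have "continuous_on {-1..1::real} (\<lambda>u. \<bar>poly p u\<bar>)" by (intro continuous_intros)
  then obtain v where v: "v \<in> {-1..1}" "\<And>u. u \<in> {-1..1} \<Longrightarrow> \<bar>poly p u\<bar> \<le> \<bar>poly p v\<bar>"
    using continuous_attains_sup[of "{-1..1::real}" "\<lambda>u. \<bar>poly p u\<bar>"] by fastforce
  obtain m where m: "m \<le> n" "\<bar>(real n - 2 * real m) / real n - v\<bar> \<le> 1 / real n"
    using ex_grid_point_near[of n v] n(1) v(1) by (auto simp: abs_le_iff)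
  define g where "g = (real n - 2 * real m) / real n"
  have g: "\<bar>g\<bar> \<le> 1" using m(1) n(1) by (auto simp: g_def field_simps abs_le_iff)
  define \<theta> \<gamma> where "\<theta> = arccos v" and "\<gamma> = arccos g"
  have angles: "\<theta> \<in> {0..pi}" "\<gamma> \<in> {0..pi}" "cos \<theta> = v" "cos \<gamma> = g"
    using v(1) g by (auto simp: \<theta>_def \<gamma>_def arccos_lbound arccos_ubound abs_le_iff)
  have "(\<gamma> - \<theta>)\<^sup>2 / 8 \<le> 1 / real n"
    using sq_div_8_le_abs_cos_diff[OF angles(2,1)] m(2) by (simp add: angles g_def)
  then have dist: "(\<gamma> - \<theta>)\<^sup>2 \<le> 8 / real n" by simp
  have "\<bar>poly p (cos \<gamma>) - poly p (cos \<theta>)\<bar> \<le> (real d)\<^sup>2 * \<bar>poly p (cos \<theta>)\<bar> * (\<gamma> - \<theta>)\<^sup>2 / 2"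
    by (rule trig_poly_near_max[OF trig_poly_poly_cos[OF deg]]) (simp add: v(2) angles)
  also have "\<dots> \<le> (real d)\<^sup>2 * \<bar>poly p (cos \<theta>)\<bar> * (8 / real n) / 2"
    by (intro divide_right_mono mult_left_mono dist) auto
  also have "\<dots> = (16 * (real d)\<^sup>2 / real n) * \<bar>poly p v\<bar> / 4"
    by (simp add: angles)
  also have "\<dots> \<le> 1 * \<bar>poly p v\<bar> / 4"
    using n by (intro divide_right_mono mult_right_mono) (auto simp: divide_le_eq_1)
  finally have "\<bar>poly p g - poly p v\<bar> \<le> \<bar>poly p v\<bar> / 2" by (simp add: angles)
  moreover have "\<bar>poly p g\<bar> \<le> M" using grid[OF m(1)] by (simp only: g_def)
  moreover have "\<bar>poly p u\<bar> \<le> \<bar>poly p v\<bar>" using v(2)[of u] u by (simp add: abs_le_iff)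
  ultimately show ?thesis by linarith
qed

section \<open>Fourier analysis on the cube\<close>

declare One_nat_def [simp del]

abbreviation chi :: "nat set \<Rightarrow> (nat \<Rightarrow> real) \<Rightarrow> real" where
  "chi S x \<equiv> \<Prod>i\<in>S. x i"

definition cube_deriv :: "((nat \<Rightarrow> real) \<Rightarrow> real) \<Rightarrow> nat \<Rightarrow> (nat \<Rightarrow> real) \<Rightarrow> real" where
  "cube_deriv f i x = (f x - f (x(i := - x i))) / 2"

lemma card_cube: "card (cube n) = 2 ^ n"
  by (simp add: cube_def card_PiE numeral_2_eq_2)

lemma cube_nonempty: "cube n \<noteq> {}"
  using card_cube[of n] by auto

lemma cube_coord: "x \<in> cube n \<Longrightarrow> i \<in> {1..n} \<Longrightarrow> x i = 1 \<or> x i = -1"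
  by (auto simp: cube_def PiE_def Pi_def)

lemma cube_coord_sq: "x \<in> cube n \<Longrightarrow> i \<in> {1..n} \<Longrightarrow> x i * x i = 1"
  using cube_coord by fastforce

lemma abs_coord_mult:
  "x \<in> cube n \<Longrightarrow> i \<in> {1..n} \<Longrightarrow> \<bar>x i * y\<bar> = \<bar>y\<bar>"
  using cube_coord[of x n i] by (auto simp: abs_mult)

lemma cube_flip: "x \<in> cube n \<Longrightarrow> i \<in> {1..n} \<Longrightarrow> x(i := - x i) \<in> cube n"
  using cube_coord[of x n i] by (auto simp: cube_def PiE_def Pi_def extensional_def)

lemma cube_expansion:
  "x \<in> cube n \<Longrightarrow> f x = (\<Sum>S\<in>Pow {1..n}. multilinear_coeff n f S * chi S x)"
  using theI'[OF multilinear_rep_ex1[of n f]]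
  by (simp add: multilinear_coeff_def multilinear_rep_def)

lemma sum_cube_expansion_mult_chi:
  assumes "T \<subseteq> {1..n}"
  shows "(\<Sum>x\<in>cube n. (\<Sum>S\<in>Pow {1..n}. c S * chi S x) * chi T x) = 2 ^ n * c T"
proof -
  have "(\<Sum>x\<in>cube n. (\<Sum>S\<in>Pow {1..n}. c S * chi S x) * chi T x) =
    (\<Sum>S\<in>Pow {1..n}. c S * (\<Sum>x\<in>cube n. chi S x * chi T x))"
    unfolding sum_distrib_right sum_distrib_left by (subst sum.swap) (simp add: mult.assoc)
  also have "\<dots> = (\<Sum>S\<in>Pow {1..n}. if S = T then c S * 2 ^ n else 0)"
    using assms by (intro sum.cong refl) (simp add: sum_cube_prod_mult)
  also have "\<dots> = 2 ^ n * c T" using assms by simp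
  finally show ?thesis .
qed

lemma sum_cube_expansion_sq:
  "(\<Sum>x\<in>cube n. (\<Sum>S\<in>Pow {1..n}. c S * chi S x)\<^sup>2) = 2 ^ n * (\<Sum>S\<in>Pow {1..n}. (c S)\<^sup>2)"
proof -
  have "(\<Sum>x\<in>cube n. (\<Sum>S\<in>Pow {1..n}. c S * chi S x)\<^sup>2) =
    (\<Sum>x\<in>cube n. \<Sum>T\<in>Pow {1..n}. c T * ((\<Sum>S\<in>Pow {1..n}. c S * chi S x) * chi T x))"
    unfolding power2_eq_square by (simp only: sum_distrib_left mult_ac)
  also have "\<dots> = (\<Sum>T\<in>Pow {1..n}. c T * (\<Sum>x\<in>cube n. (\<Sum>S\<in>Pow {1..n}. c S * chi S x) * chi T x))"
    by (subst sum.swap) (simp add: sum_distrib_left)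
  also have "\<dots> = (\<Sum>T\<in>Pow {1..n}. 2 ^ n * (c T)\<^sup>2)"
    by (intro sum.cong refl)
       (simp add: sum_cube_expansion_mult_chi power2_eq_square)
  finally show ?thesis by (simp add: sum_distrib_left)
qed

lemma multilinear_coeff_eq:
  assumes "T \<subseteq> {1..n}"
  shows "multilinear_coeff n f T = (\<Sum>x\<in>cube n. f x * chi T x) / 2 ^ n"
proof -
  have "(\<Sum>x\<in>cube n. f x * chi T x) =
    (\<Sum>x\<in>cube n. (\<Sum>S\<in>Pow {1..n}. multilinear_coeff n f S * chi S x) * chi T x)"
    by (intro sum.cong refl) (simp only: cube_expansion[symmetric])
  also have "\<dots> = 2 ^ n * multilinear_coeff n f T"
    by (rule sum_cube_expansion_mult_chi[OF assms])
  finally show ?thesis by simp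
qed

lemma card_le_cube_degree:
  assumes "S \<subseteq> {1..n}" "multilinear_coeff n f S \<noteq> 0"
  shows "card S \<le> cube_degree n f"
proof -
  have "finite {S. S \<subseteq> {1..n} \<and> multilinear_coeff n f S \<noteq> 0}"
    by (rule finite_subset[of _ "Pow {1..n}"]) auto
  then show ?thesis unfolding cube_degree_def using assms by (intro Max_ge) auto
qed

lemma cube_bound_nonneg:
  assumes "f \<in> cube n \<rightarrow> {-M..M::real}"
  shows "0 \<le> M"
proof -
  obtain x where "x \<in> cube n" using cube_nonempty by blast
  then have "f x \<in> {-M..M}" using assms by blast
  then show ?thesis by simp
qed

lemma sum_multilinear_coeff_sq_le:
  assumes "f \<in> cube n \<rightarrow> {-M..M}"
  shows "(\<Sum>S\<in>Pow {1..n}. (multilinear_coeff n f S)\<^sup>2) \<le> M\<^sup>2"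
proof -
  have "2 ^ n * (\<Sum>S\<in>Pow {1..n}. (multilinear_coeff n f S)\<^sup>2) = (\<Sum>x\<in>cube n. (f x)\<^sup>2)"
    unfolding sum_cube_expansion_sq[symmetric]
    by (intro sum.cong refl) (simp only: cube_expansion[symmetric])
  also have "\<dots> \<le> (\<Sum>x\<in>cube n. M\<^sup>2)"
  proof (rule sum_mono)
    fix x assume "x \<in> cube n"
    then have "f x \<in> {-M..M}" using assms by blast
    then show "(f x)\<^sup>2 \<le> M\<^sup>2" by (intro abs_le_square_iff[THEN iffD1]) auto
  qed
  finally show ?thesis by (simp add: card_cube)
qed

lemma chi_flip:
  assumes "finite S"
  shows "chi S (x(i := - x i)) = (if i \<in> S then - chi S x else chi S x)"
proof (cases "i \<in> S")
  case True
  have "chi (S - {i}) (x(i := - x i)) = chi (S - {i}) x"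
    by (rule prod.cong) auto
  then show ?thesis
    using True by (simp add: prod.remove[OF assms True])
next
  case False
  then show ?thesis by (auto intro: prod.cong)
qed

lemma cube_deriv_expansion:
  assumes x: "x \<in> cube n" and i: "i \<in> {1..n}"
  shows "cube_deriv f i x =
    (\<Sum>S\<in>Pow {1..n}. (if i \<in> S then multilinear_coeff n f S else 0) * chi S x)"
proof -
  have "cube_deriv f i x =
    (\<Sum>S\<in>Pow {1..n}.
      (multilinear_coeff n f S * chi S x - multilinear_coeff n f S * chi S (x(i := - x i))) / 2)"
    unfolding cube_deriv_def cube_expansion[OF x, of f] cube_expansion[OF cube_flip[OF x i], of f]
    by (simp only: sum_subtractf sum_divide_distrib[symmetric])
  also have "\<dots> = (\<Sum>S\<in>Pow {1..n}. (if i \<in> S then multilinear_coeff n f S else 0) * chi S x)"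
    by (intro sum.cong refl) (auto simp: chi_flip finite_subset simp del: fun_upd_apply)
  finally show ?thesis .
qed

lemma sum_coord_mult_cube_deriv:
  assumes i: "i \<in> {1..n}"
  shows "(\<Sum>x\<in>cube n. x i * cube_deriv f i x) = 2 ^ n * multilinear_coeff n f {i}"
proof -
  have "(\<Sum>x\<in>cube n. x i * cube_deriv f i x) = (\<Sum>x\<in>cube n.
    (\<Sum>S\<in>Pow {1..n}. (if i \<in> S then multilinear_coeff n f S else 0) * chi S x) * chi {i} x)"
    by (intro sum.cong refl) (simp add: cube_deriv_expansion[OF _ i])
  also have "\<dots> = 2 ^ n * multilinear_coeff n f {i}"
    using i by (subst sum_cube_expansion_mult_chi) auto
  finally show ?thesis .
qed

lemma sum_cube_deriv_sq:
  "(\<Sum>i=1..n. \<Sum>x\<in>cube n. (cube_deriv f i x)\<^sup>2) =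
    2 ^ n * (\<Sum>S\<in>Pow {1..n}. real (card S) * (multilinear_coeff n f S)\<^sup>2)"
proof -
  let ?c = "multilinear_coeff n f"
  have "(\<Sum>i=1..n. \<Sum>x\<in>cube n. (cube_deriv f i x)\<^sup>2) =
      (\<Sum>i=1..n. 2 ^ n * (\<Sum>S\<in>Pow {1..n}. (if i \<in> S then ?c S else 0)\<^sup>2))"
    unfolding sum_cube_expansion_sq[symmetric]
    by (intro sum.cong refl) (simp only: cube_deriv_expansion)
  also have "\<dots> = 2 ^ n * (\<Sum>S\<in>Pow {1..n}. \<Sum>i=1..n. if i \<in> S then (?c S)\<^sup>2 else 0)"
    unfolding sum_distrib_left[symmetric]
    by (subst sum.swap) (simp add: if_distrib[of "\<lambda>y. y\<^sup>2"] cong: if_cong)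
  also have "(\<Sum>S\<in>Pow {1..n}. \<Sum>i=1..n. if i \<in> S then (?c S)\<^sup>2 else 0) =
      (\<Sum>S\<in>Pow {1..n}. real (card S) * (?c S)\<^sup>2)"
    by (intro sum.cong refl) (auto simp: sum.inter_restrict[symmetric] Int_absorb1)
  finally show ?thesis .
qed

lemma sum_cube_deriv_sq_le:
  assumes "f \<in> cube n \<rightarrow> {-M..M}"
  shows "(\<Sum>i=1..n. \<Sum>x\<in>cube n. (cube_deriv f i x)\<^sup>2) \<le> 2 ^ n * (real (cube_degree n f) * M\<^sup>2)"
proof -
  let ?c = "multilinear_coeff n f"
  have "(\<Sum>S\<in>Pow {1..n}. real (card S) * (?c S)\<^sup>2) \<le> (\<Sum>S\<in>Pow {1..n}. real (cube_degree n f) * (?c S)\<^sup>2)"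
  proof (rule sum_mono)
    fix S assume "S \<in> Pow {1..n}"
    then show "real (card S) * (?c S)\<^sup>2 \<le> real (cube_degree n f) * (?c S)\<^sup>2"
      using card_le_cube_degree[of S n f] by (cases "?c S = 0") (auto intro: mult_right_mono)
  qed
  also have "\<dots> \<le> real (cube_degree n f) * M\<^sup>2"
    unfolding sum_distrib_left[symmetric]
    by (intro mult_left_mono sum_multilinear_coeff_sq_le assms) simp
  finally show ?thesis by (simp add: sum_cube_deriv_sq)
qed

section \<open>The multilinear extension on the diagonal\<close>

text \<open>\<open>biased_weight n \<rho>\<close> is the density of the product measure with all coordinate means \<open>\<rho>\<close>.\<close>

definition biased_weight :: "nat \<Rightarrow> real \<Rightarrow> (nat \<Rightarrow> real) \<Rightarrow> real" where
  "biased_weight n \<rho> x = (\<Prod>i=1..n. (1 + \<rho> * x i) / 2)"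

definition diagonal_poly :: "nat \<Rightarrow> ((nat \<Rightarrow> real) \<Rightarrow> real) \<Rightarrow> real poly" where
  "diagonal_poly n f = (\<Sum>S\<in>Pow {1..n}. monom (multilinear_coeff n f S) (card S))"

lemma biased_weight_nonneg:
  assumes "\<bar>\<rho>\<bar> \<le> 1" "x \<in> cube n"
  shows "biased_weight n \<rho> x \<ge> 0"
  unfolding biased_weight_def
proof (rule prod_nonneg)
  fix i assume "i \<in> {1..n}"
  then have "x i = 1 \<or> x i = -1" using cube_coord[OF assms(2)] by blast
  then show "0 \<le> (1 + \<rho> * x i) / 2" using assms(1) by auto
qed

lemma sum_biased_weight_mult_chi:
  assumes "S \<subseteq> {1..n}"
  shows "(\<Sum>x\<in>cube n. biased_weight n \<rho> x * chi S x) = \<rho> ^ card S"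
proof -
  have "chi S x = (\<Prod>i=1..n. if i \<in> S then x i else 1)" for x :: "nat \<Rightarrow> real"
    using assms by (simp add: prod.inter_restrict[symmetric] Int_absorb1)
  then have "(\<Sum>x\<in>cube n. biased_weight n \<rho> x * chi S x) =
     (\<Sum>x\<in>cube n. \<Prod>i=1..n. (1 + \<rho> * x i) / 2 * (if i \<in> S then x i else 1))"
    by (simp only: biased_weight_def prod.distrib)
  also have "\<dots> = (\<Prod>i=1..n. \<Sum>y\<in>{-1, 1}. (1 + \<rho> * y) / 2 * (if i \<in> S then y else 1))"
    unfolding cube_def by (rule prod_sum_PiE[symmetric]) auto
  also have "\<dots> = (\<Prod>i=1..n. if i \<in> S then \<rho> else 1)"
    by (intro prod.cong) (auto simp: field_simps)
  also have "\<dots> = \<rho> ^ card S"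
    using assms by (simp add: prod.inter_restrict[symmetric] Int_absorb1)
  finally show ?thesis .
qed

lemma poly_diagonal_poly: "poly (diagonal_poly n f) \<rho> = (\<Sum>x\<in>cube n. biased_weight n \<rho> x * f x)"
proof -
  let ?c = "multilinear_coeff n f"
  have "poly (diagonal_poly n f) \<rho> = (\<Sum>S\<in>Pow {1..n}. ?c S * (\<Sum>x\<in>cube n. biased_weight n \<rho> x * chi S x))"
    by (simp add: diagonal_poly_def poly_sum poly_monom sum_biased_weight_mult_chi)
  also have "\<dots> = (\<Sum>x\<in>cube n. biased_weight n \<rho> x * (\<Sum>S\<in>Pow {1..n}. ?c S * chi S x))"
    unfolding sum_distrib_left by (subst sum.swap) (simp add: mult_ac)
  also have "\<dots> = (\<Sum>x\<in>cube n. biased_weight n \<rho> x * f x)"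
    by (intro sum.cong refl) (simp only: cube_expansion[symmetric])
  finally show ?thesis .
qed

lemma abs_poly_diagonal_poly_le:
  assumes f: "f \<in> cube n \<rightarrow> {-M..M}" and \<rho>: "\<bar>\<rho>\<bar> \<le> 1"
  shows "\<bar>poly (diagonal_poly n f) \<rho>\<bar> \<le> M"
proof -
  have "\<bar>poly (diagonal_poly n f) \<rho>\<bar> \<le> (\<Sum>x\<in>cube n. \<bar>biased_weight n \<rho> x * f x\<bar>)"
    unfolding poly_diagonal_poly by (rule sum_abs)
  also have "\<dots> \<le> (\<Sum>x\<in>cube n. biased_weight n \<rho> x * M)"
  proof (rule sum_mono)
    fix x assume x: "x \<in> cube n"
    then have "f x \<in> {-M..M}" using f by blast
    then have "\<bar>f x\<bar> \<le> M" by auto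
    then show "\<bar>biased_weight n \<rho> x * f x\<bar> \<le> biased_weight n \<rho> x * M"
      using biased_weight_nonneg[OF \<rho> x] by (simp add: abs_mult mult_left_mono)
  qed
  also have "\<dots> = M"
    using sum_biased_weight_mult_chi[of "{}" n \<rho>] by (simp flip: sum_distrib_right)
  finally show ?thesis .
qed

lemma degree_diagonal_poly_le: "degree (diagonal_poly n f) \<le> cube_degree n f"
  unfolding diagonal_poly_def
proof (rule degree_sum_le)
  fix S assume "S \<in> Pow {1..n}"
  then show "degree (monom (multilinear_coeff n f S) (card S)) \<le> cube_degree n f"
    using card_le_cube_degree[of S n f]
    by (cases "multilinear_coeff n f S = 0") (auto simp: degree_monom_eq)
qed simp

lemma coeff_diagonal_poly_1: "coeff (diagonal_poly n f) 1 = (\<Sum>i=1..n. multilinear_coeff n f {i})"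
proof -
  have "coeff (diagonal_poly n f) 1 = (\<Sum>S\<in>{S \<in> Pow {1..n}. card S = 1}. multilinear_coeff n f S)"
    unfolding diagonal_poly_def by (subst sum.inter_filter) (simp_all add: coeff_sum)
  also have "{S \<in> Pow {1..n}. card S = 1} = (\<lambda>i. {i}) ` {1..n}"
    by (auto simp: card_1_singleton_iff One_nat_def)
  also have "(\<Sum>S\<in>(\<lambda>i. {i}) ` {1..n}. multilinear_coeff n f S) = (\<Sum>i=1..n. multilinear_coeff n f {i})"
    by (subst sum.reindex) auto
  finally show ?thesis .
qed

lemma abs_sum_linear_coeffs_le:
  assumes "f \<in> cube n \<rightarrow> {-M..M}"
  shows "\<bar>\<Sum>i=1..n. multilinear_coeff n f {i}\<bar> \<le> real (cube_degree n f) * M"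
  using poly_bernstein_first
    [OF degree_diagonal_poly_le[of n f] abs_poly_diagonal_poly_le[OF assms], of 0]
  by (simp add: poly_0_coeff_0 coeff_pderiv coeff_diagonal_poly_1 flip: One_nat_def)

section \<open>Symmetric functions as polynomials in the mean coordinate\<close>

definition elementary_symmetric :: "nat \<Rightarrow> nat \<Rightarrow> (nat \<Rightarrow> real) \<Rightarrow> real" where
  "elementary_symmetric n k x = (\<Sum>S | S \<subseteq> {1..n} \<and> card S = k. chi S x)"

text \<open>The recursion compares coefficients in \<open>(1 - z\<^sup>2) P' = (\<Sum>\<^sub>i x\<^sub>i - n z) P\<close>, which holds for the
  generating polynomial \<open>P = \<Prod>\<^sub>i (1 + x\<^sub>i z)\<close> of the elementary symmetric polynomials on the cube.\<close>

fun krawtchouk_poly :: "nat \<Rightarrow> nat \<Rightarrow> real poly" where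
  "krawtchouk_poly n 0 = 1"
| "krawtchouk_poly n (Suc 0) = [:0, 1:]"
| "krawtchouk_poly n (Suc (Suc k)) =
     smult (1 / real (k + 2))
       ([:0, 1:] * krawtchouk_poly n (Suc k) - smult (real n - real k) (krawtchouk_poly n k))"

definition coord_mean :: "nat \<Rightarrow> (nat \<Rightarrow> real) \<Rightarrow> real" where
  "coord_mean n x = (\<Sum>i=1..n. x i) / real n"

lemma coeff_prod_linear: "coeff (\<Prod>i=1..n. [:1, x i:]) k = elementary_symmetric n k x"
proof -
  have "(\<Prod>i=1..n. [:1, x i:]) = (\<Prod>i=1..n. monom (x i) 1 + 1)"
    by (intro prod.cong refl) (simp add: monom_altdef one_pCons)
  also have "\<dots> = (\<Sum>S\<in>Pow {1..n}. \<Prod>i\<in>S. monom (x i) 1)"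
    by (subst prod_add) simp_all
  also have "\<dots> = (\<Sum>S\<in>Pow {1..n}. monom (chi S x) (card S))"
  proof (rule sum.cong[OF refl])
    fix S assume "S \<in> Pow {1..n}"
    then have "finite S" using finite_subset by blast
    then show "(\<Prod>i\<in>S. monom (x i) 1) = monom (chi S x) (card S)"
      by induction (simp_all add: mult_monom One_nat_def)
  qed
  finally have "coeff (\<Prod>i=1..n. [:1, x i:]) k = (\<Sum>S\<in>Pow {1..n}. if card S = k then chi S x else 0)"
    by (simp add: coeff_sum)
  also have "\<dots> = elementary_symmetric n k x"
    by (simp add: elementary_symmetric_def sum.inter_filter[symmetric] Pow_def)
  finally show ?thesis .
qed

lemma elementary_symmetric_0: "elementary_symmetric n 0 x = 1"
  using poly_prod[of "\<lambda>i. [:1, x i:]" "{1..n}" 0]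
  by (simp add: poly_0_coeff_0 coeff_prod_linear)

lemma prod_linear_cube_differential_equation:
  assumes x: "x \<in> cube n"
  defines "P \<equiv> \<Prod>i=1..n. [:1, x i:]"
  shows "[:1, 0, -1:] * pderiv P = [:\<Sum>i=1..n. x i, - real n:] * P"
proof -
  have "[:1, 0, -1:] * pderiv P = (\<Sum>i=1..n. [:x i, -1:] * P)"
    unfolding P_def pderiv_prod sum_distrib_left
  proof (rule sum.cong[OF refl])
    fix i assume i: "i \<in> {1..n}"
    let ?R = "\<Prod>j\<in>{1..n} - {i}. [:1, x j:]"
    have factor: "[:1, 0, -1:] = [:1, - x i:] * [:1, x i:]"
      and coord_sq: "[:1, - x i:] * [:x i:] = [:x i, -1:]"
      using cube_coord_sq[OF x i] by simp_all
    have pderiv: "pderiv [:1, x i:] = [:x i:]"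
      by (simp add: pderiv_pCons)
    have remove: "(\<Prod>j=1..n. [:1, x j:]) = [:1, x i:] * ?R"
      using i by (intro prod.remove) auto
    have "[:1, 0, -1:] * (?R * pderiv [:1, x i:]) = ([:1, - x i:] * [:x i:]) * ([:1, x i:] * ?R)"
      unfolding factor pderiv by (simp only: mult_ac)
    then show "[:1, 0, -1:] * (?R * pderiv [:1, x i:]) = [:x i, -1:] * (\<Prod>j=1..n. [:1, x j:])"
      by (simp only: remove coord_sq)
  qed
  also have "\<dots> = (\<Sum>i=1..n. [:x i, -1:]) * P" by (simp only: sum_distrib_right)
  also have "(\<Sum>i=1..n. [:x i, -1:]) = [:\<Sum>i=1..n. x i, - real n:]"
    by (induction n) simp_all
  finally show ?thesis .
qed

lemma elementary_symmetric_1: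
  assumes "x \<in> cube n"
  shows "elementary_symmetric n 1 x = (\<Sum>i=1..n. x i)"
  using arg_cong[OF prod_linear_cube_differential_equation[OF assms], of "\<lambda>p. coeff p 0"]
  by (simp add: coeff_pderiv coeff_prod_linear elementary_symmetric_0 flip: One_nat_def)

lemma elementary_symmetric_recurrence:
  assumes "x \<in> cube n"
  shows "real (k + 2) * elementary_symmetric n (Suc (Suc k)) x =
    (\<Sum>i=1..n. x i) * elementary_symmetric n (Suc k) x - (real n - real k) * elementary_symmetric n k x"
  using arg_cong[OF prod_linear_cube_differential_equation[OF assms], of "\<lambda>p. coeff p (Suc k)"]
  by (cases k) (simp_all add: coeff_pderiv coeff_prod_linear algebra_simps)

lemma elementary_symmetric_eq_krawtchouk_poly:
  assumes "x \<in> cube n"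
  shows "elementary_symmetric n k x = poly (krawtchouk_poly n k) (\<Sum>i=1..n. x i)"
proof (induction k rule: induct_nat_012)
  case 0
  show ?case by (simp add: elementary_symmetric_0)
next
  case 1
  show ?case using elementary_symmetric_1[OF assms] by (simp add: One_nat_def)
next
  case (ge2 k)
  then show ?case
    using elementary_symmetric_recurrence[OF assms, of k] by (simp add: field_simps)
qed

lemma degree_krawtchouk_poly_le: "degree (krawtchouk_poly n k) \<le> k"
proof (induction k rule: induct_nat_012)
  case (ge2 k)
  have "degree ([:0, 1:] * krawtchouk_poly n (Suc k)) \<le> Suc (Suc k)"
    using degree_mult_le[of "[:0, 1:]" "krawtchouk_poly n (Suc k)"] ge2(2) by simp
  then show ?case
    using ge2(1)
    by (auto intro!: order_trans[OF degree_smult_le] degree_diff_le simp del: mult_pCons_left)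
qed simp_all

lemma cube_permute:
  assumes "\<pi> permutes {1..n}" "x \<in> cube n"
  shows "x \<circ> \<pi> \<in> cube n"
  using assms permutes_in_image[OF assms(1)] permutes_not_in[OF assms(1)]
  by (fastforce simp: cube_def PiE_def Pi_def extensional_def)

lemma cube_symmetric_permute:
  assumes "cube_symmetric n f" "\<pi> permutes {1..n}" "x \<in> cube n"
  shows "f (x \<circ> \<pi>) = f x"
proof -
  have "(\<Sum>i=1..n. (x \<circ> \<pi>) i) = (\<Sum>i=1..n. x i)"
    using sum.permute[OF assms(2), of x] by simp
  then show ?thesis
    using assms cube_permute unfolding cube_symmetric_def by blast
qed

lemma multilinear_coeff_permute:
  assumes f: "cube_symmetric n f" and \<pi>: "\<pi> permutes {1..n}" and S: "S \<subseteq> {1..n}"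
  shows "multilinear_coeff n f (\<pi> ` S) = multilinear_coeff n f S"
proof -
  have "\<pi> ` S \<subseteq> {1..n}"
    using S permutes_image[OF \<pi>] by blast
  moreover have "(\<Sum>x\<in>cube n. f x * chi (\<pi> ` S) x) = (\<Sum>x\<in>cube n. f x * chi S x)"
  proof (rule sum.reindex_bij_witness[where i = "\<lambda>x. x \<circ> inv \<pi>" and j = "\<lambda>x. x \<circ> \<pi>"])
    fix x assume x: "x \<in> cube n"
    show "x \<circ> \<pi> \<in> cube n" "x \<circ> inv \<pi> \<in> cube n"
      by (rule cube_permute[OF \<pi> x] cube_permute[OF permutes_inv[OF \<pi>] x])+
    show "x \<circ> \<pi> \<circ> inv \<pi> = x" "x \<circ> inv \<pi> \<circ> \<pi> = x"
      using permutes_inv_o[OF \<pi>] by (simp_all add: comp_assoc)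
    show "f (x \<circ> \<pi>) * chi S (x \<circ> \<pi>) = f x * chi (\<pi> ` S) x"
      by (simp add: cube_symmetric_permute[OF f \<pi> x] prod.reindex permutes_inj_on[OF \<pi>])
  qed
  ultimately show ?thesis
    using S by (simp add: multilinear_coeff_eq)
qed

lemma ex_permutes_image_eq:
  assumes "finite A" "S \<subseteq> A" "T \<subseteq> A" "card S = card T"
  shows "\<exists>\<pi>. \<pi> permutes A \<and> \<pi> ` S = T"
proof -
  have fin: "finite S" "finite T" using assms finite_subset by blast+
  obtain g where g: "bij_betw g S T"
    using finite_same_card_bij[OF fin assms(4)] by blast
  have "card (A - S) = card (A - T)"
    using assms fin by (simp add: card_Diff_subset)
  then obtain h where h: "bij_betw h (A - S) (A - T)"
    using finite_same_card_bij[of "A - S" "A - T"] assms(1) by blast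
  define \<pi> where "\<pi> i = (if i \<in> S then g i else if i \<in> A then h i else i)" for i
  have \<pi>_S: "bij_betw \<pi> S T"
    using g by (subst bij_betw_cong[of S \<pi> g]) (auto simp: \<pi>_def)
  have "bij_betw \<pi> (A - S) (A - T)"
    using h by (subst bij_betw_cong[of "A - S" \<pi> h]) (auto simp: \<pi>_def)
  from bij_betw_combine[OF \<pi>_S this]
  have "bij_betw \<pi> A A" using assms by (simp add: Un_absorb1)
  then have "\<pi> permutes A"
    by (rule bij_imp_permutes) (use assms(2) in \<open>auto simp: \<pi>_def\<close>)
  then show ?thesis using \<pi>_S bij_betw_imp_surj_on by blast
qed

lemma multilinear_coeff_symmetric:
  assumes "cube_symmetric n f" "S \<subseteq> {1..n}" "T \<subseteq> {1..n}" "card S = card T"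
  shows "multilinear_coeff n f S = multilinear_coeff n f T"
  using ex_permutes_image_eq[OF finite_atLeastAtMost assms(2-4)]
    multilinear_coeff_permute[OF assms(1) _ assms(2)] by metis

lemma cube_symmetric_expansion:
  assumes f: "cube_symmetric n f" and x: "x \<in> cube n"
  shows "f x = (\<Sum>k\<le>n. multilinear_coeff n f {1..k} * elementary_symmetric n k x)"
proof -
  let ?c = "multilinear_coeff n f"
  have "f x = (\<Sum>S\<in>Pow {1..n}. ?c S * chi S x)" by (rule cube_expansion[OF x])
  also have "\<dots> = (\<Sum>k\<le>n. \<Sum>S | S \<in> Pow {1..n} \<and> card S = k. ?c S * chi S x)"
    by (rule sum.group[symmetric]) (use card_mono[of "{1..n}"] in auto)
  also have "\<dots> = (\<Sum>k\<le>n. ?c {1..k} * elementary_symmetric n k x)"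
    unfolding elementary_symmetric_def sum_distrib_left
  proof (intro sum.cong)
    fix k S assume "k \<in> {..n}" "S \<in> {S. S \<subseteq> {1..n} \<and> card S = k}"
    then show "?c S * chi S x = ?c {1..k} * chi S x"
      using multilinear_coeff_symmetric[OF f, of S "{1..k}"] by auto
  qed auto
  finally show ?thesis .
qed

lemma cube_symmetric_eq_poly_sum:
  assumes "cube_symmetric n f"
  shows "\<exists>p. degree p \<le> cube_degree n f \<and> (\<forall>x\<in>cube n. f x = poly p (\<Sum>i=1..n. x i))"
proof (intro exI conjI ballI)
  let ?c = "multilinear_coeff n f"
  let ?p = "\<Sum>k\<le>n. smult (?c {1..k}) (krawtchouk_poly n k)"
  show "degree ?p \<le> cube_degree n f"
  proof (rule degree_sum_le)
    fix k assume "k \<in> {..n}"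
    then have "?c {1..k} = 0 \<or> k \<le> cube_degree n f"
      using card_le_cube_degree[of "{1..k}" n f] by auto
    then show "degree (smult (?c {1..k}) (krawtchouk_poly n k)) \<le> cube_degree n f"
      using degree_krawtchouk_poly_le[of n k] by auto
  qed simp
  show "f x = poly ?p (\<Sum>i=1..n. x i)" if "x \<in> cube n" for x
    by (simp add: cube_symmetric_expansion[OF assms that]
        elementary_symmetric_eq_krawtchouk_poly[OF that] poly_sum)
qed

lemma cube_symmetric_eq_poly_coord_mean:
  assumes "cube_symmetric n f"
  shows "\<exists>P. degree P \<le> cube_degree n f \<and> (\<forall>x\<in>cube n. f x = poly P (coord_mean n x))"
proof -
  obtain p where p: "degree p \<le> cube_degree n f" "\<forall>x\<in>cube n. f x = poly p (\<Sum>i=1..n. x i)"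
    using cube_symmetric_eq_poly_sum[OF assms] by blast
  show ?thesis
  proof (intro exI conjI ballI)
    show "degree (pcompose p [:0, real n:]) \<le> cube_degree n f"
      using p(1) by (simp add: degree_pcompose)
    show "f x = poly (pcompose p [:0, real n:]) (coord_mean n x)" if "x \<in> cube n" for x
      using p(2) that by (simp add: poly_pcompose coord_mean_def)
  qed
qed

section \<open>Influence and concentration\<close>

definition influence_on :: "nat \<Rightarrow> ((nat \<Rightarrow> real) \<Rightarrow> real) \<Rightarrow> (nat \<Rightarrow> real) set \<Rightarrow> real" where
  "influence_on n f A = (\<Sum>i=1..n. \<Sum>x\<in>A. \<bar>cube_deriv f i x\<bar>) / 2 ^ n"

definition signed_influence_on :: "nat \<Rightarrow> ((nat \<Rightarrow> real) \<Rightarrow> real) \<Rightarrow> (nat \<Rightarrow> real) set \<Rightarrow> real" where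
  "signed_influence_on n f A = (\<Sum>i=1..n. \<Sum>x\<in>A. x i * cube_deriv f i x) / 2 ^ n"

lemma total_influence_eq_influence_on: "total_influence n f = influence_on n f (cube n)"
  by (simp add: total_influence_def influence_on_def cube_deriv_def integral_pmf_of_set cube_nonempty
      card_cube sum_divide_distrib mult.commute)

lemma influence_on_split:
  "W \<subseteq> cube n \<Longrightarrow> influence_on n f (cube n) = influence_on n f W + influence_on n f (cube n - W)"
  by (simp add: influence_on_def sum.subset_diff[of W "cube n"] sum.distrib add_divide_distrib)

lemma signed_influence_on_split:
  "W \<subseteq> cube n \<Longrightarrow>
    signed_influence_on n f (cube n) = signed_influence_on n f W + signed_influence_on n f (cube n - W)"
  by (simp add: signed_influence_on_def sum.subset_diff[of W "cube n"] sum.distrib add_divide_distrib)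

lemma abs_signed_influence_on_le:
  assumes "A \<subseteq> cube n"
  shows "\<bar>signed_influence_on n f A\<bar> \<le> influence_on n f A"
proof -
  have "\<bar>\<Sum>i=1..n. \<Sum>x\<in>A. x i * cube_deriv f i x\<bar> \<le> (\<Sum>i=1..n. \<Sum>x\<in>A. \<bar>x i * cube_deriv f i x\<bar>)"
    by (intro order_trans[OF sum_abs] sum_mono sum_abs)
  also have "\<dots> = (\<Sum>i=1..n. \<Sum>x\<in>A. \<bar>cube_deriv f i x\<bar>)"
    using assms by (intro sum.cong refl) (auto simp: abs_coord_mult)
  finally show ?thesis
    by (simp add: signed_influence_on_def influence_on_def divide_right_mono)
qed

lemma signed_influence_on_cube:
  "signed_influence_on n f (cube n) = (\<Sum>i=1..n. multilinear_coeff n f {i})"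
  by (simp add: signed_influence_on_def sum_coord_mult_cube_deriv sum_divide_distrib)

lemma total_influence_le_of_constant_sign:
  assumes f: "f \<in> cube n \<rightarrow> {-M..M}" and W: "W \<subseteq> cube n" and \<epsilon>: "\<bar>\<epsilon>\<bar> = 1"
    and sgn: "\<And>i x. i \<in> {1..n} \<Longrightarrow> x \<in> W \<Longrightarrow> 0 \<le> \<epsilon> * (x i * cube_deriv f i x)"
  shows "total_influence n f \<le> real (cube_degree n f) * M + 2 * influence_on n f (cube n - W)"
proof -
  have "\<bar>cube_deriv f i x\<bar> = \<epsilon> * (x i * cube_deriv f i x)" if "i \<in> {1..n}" "x \<in> W" for i x
  proof -
    have "\<bar>cube_deriv f i x\<bar> = \<bar>\<epsilon> * (x i * cube_deriv f i x)\<bar>"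
      using that W \<epsilon> abs_coord_mult[of x n i] by (simp add: abs_mult[of \<epsilon>] subset_iff)
    then show ?thesis using sgn[OF that] by simp
  qed
  then have "influence_on n f W = \<epsilon> * signed_influence_on n f W"
    by (simp add: influence_on_def signed_influence_on_def sum_distrib_left)
  also have "\<dots> \<le> \<bar>\<epsilon> * signed_influence_on n f W\<bar>" by (rule abs_ge_self)
  also have "\<dots> = \<bar>signed_influence_on n f W\<bar>" by (simp add: abs_mult \<epsilon>)
  also have "\<dots> \<le> \<bar>signed_influence_on n f (cube n)\<bar> + \<bar>signed_influence_on n f (cube n - W)\<bar>"
    unfolding signed_influence_on_split[OF W] by linarith
  also have "\<dots> \<le> real (cube_degree n f) * M + influence_on n f (cube n - W)"
    unfolding signed_influence_on_cube
    by (intro add_mono abs_sum_linear_coeffs_le[OF f] abs_signed_influence_on_le) simp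
  finally show ?thesis
    by (simp add: total_influence_eq_influence_on influence_on_split[OF W])
qed

lemma total_influence_le_of_small_deriv:
  assumes W: "W \<subseteq> cube n" and "r \<ge> 0"
    and small: "\<And>i x. i \<in> {1..n} \<Longrightarrow> x \<in> W \<Longrightarrow> \<bar>cube_deriv f i x\<bar> \<le> r / real n"
  shows "total_influence n f \<le> r + influence_on n f (cube n - W)"
proof -
  have "(\<Sum>i=1..n. \<Sum>x\<in>W. \<bar>cube_deriv f i x\<bar>) \<le> (\<Sum>i=1..n. \<Sum>x\<in>W. r / real n)"
    by (intro sum_mono small)
  also have "\<dots> \<le> (\<Sum>i=1..n. \<Sum>x\<in>cube n. r / real n)"
    using W \<open>r \<ge> 0\<close> by (intro sum_mono sum_mono2) auto
  also have "\<dots> \<le> 2 ^ n * r"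
    using \<open>r \<ge> 0\<close> by (simp add: card_cube)
  finally have "influence_on n f W \<le> r"
    by (simp add: influence_on_def field_simps)
  then show ?thesis
    by (simp add: total_influence_eq_influence_on influence_on_split[OF W])
qed

lemma influence_on_le_sqrt_prob:
  assumes f: "f \<in> cube n \<rightarrow> {-M..M}" and A: "A \<subseteq> cube n"
  shows "influence_on n f A \<le>
    M * sqrt (real (cube_degree n f) * real n * measure_pmf.prob (pmf_of_set (cube n)) A)"
proof -
  let ?g = "\<lambda>(i, x). cube_deriv f i x" and ?I = "{1..n} \<times> A"
  let ?d = "real (cube_degree n f)" and ?p = "measure_pmf.prob (pmf_of_set (cube n)) A"
  have "M \<ge> 0" by (rule cube_bound_nonneg[OF f])
  have card: "real (card A) = 2 ^ n * ?p"
    using A by (simp add: measure_pmf_of_set cube_nonempty card_cube Int_absorb1)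
  have "(\<Sum>i=1..n. \<Sum>x\<in>A. \<bar>cube_deriv f i x\<bar>) = (\<Sum>z\<in>?I. \<bar>?g z\<bar> * \<bar>1\<bar>)"
    by (simp add: sum.cartesian_product case_prod_unfold)
  also have "\<dots> \<le> L2_set ?g ?I * L2_set (\<lambda>_. 1) ?I"
    by (rule L2_set_mult_ineq)
  also have "\<dots> = sqrt (\<Sum>i=1..n. \<Sum>x\<in>A. (cube_deriv f i x)\<^sup>2) * sqrt (real n * (2 ^ n * ?p))"
    by (simp add: L2_set_def sum.cartesian_product case_prod_unfold card_cartesian_product card)
  also have "\<dots> \<le> sqrt (2 ^ n * (?d * M\<^sup>2)) * sqrt (real n * (2 ^ n * ?p))"
  proof (intro mult_right_mono real_sqrt_le_mono)
    have "(\<Sum>i=1..n. \<Sum>x\<in>A. (cube_deriv f i x)\<^sup>2) \<le> (\<Sum>i=1..n. \<Sum>x\<in>cube n. (cube_deriv f i x)\<^sup>2)"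
      using A by (intro sum_mono sum_mono2) auto
    also have "\<dots> \<le> 2 ^ n * (?d * M\<^sup>2)" by (rule sum_cube_deriv_sq_le[OF f])
    finally show "(\<Sum>i=1..n. \<Sum>x\<in>A. (cube_deriv f i x)\<^sup>2) \<le> 2 ^ n * (?d * M\<^sup>2)" .
  qed simp
  also have "\<dots> = sqrt ((2 ^ n * M)\<^sup>2 * (?d * real n * ?p))"
    by (simp add: real_sqrt_mult[symmetric] power2_eq_square mult_ac)
  also have "\<dots> = 2 ^ n * (M * sqrt (?d * real n * ?p))"
    using \<open>M \<ge> 0\<close> by (subst real_sqrt_mult) simp
  finally show ?thesis by (simp add: influence_on_def field_simps)
qed

lemma pmf_of_set_cube: "pmf_of_set (cube n) = Pi_pmf {1..n} undefined (\<lambda>_. pmf_of_set {-1, 1})"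
  by (subst Pi_pmf_of_set)
     (auto simp: cube_def PiE_dflt_def PiE_def extensional_def intro!: arg_cong[of _ _ pmf_of_set])

lemma expectation_coord_cube:
  assumes "i \<in> {1..n}"
  shows "measure_pmf.expectation (pmf_of_set (cube n)) (\<lambda>x. x i) = 0"
proof -
  have "measure_pmf.expectation (pmf_of_set (cube n)) (\<lambda>x. x i) =
    measure_pmf.expectation (map_pmf (\<lambda>x. x i) (pmf_of_set (cube n))) (\<lambda>y. y)"
    by simp
  also have "map_pmf (\<lambda>x. x i) (pmf_of_set (cube n)) = pmf_of_set {-1, 1}"
    using assms by (simp add: pmf_of_set_cube Pi_pmf_component)
  also have "measure_pmf.expectation \<dots> (\<lambda>y. y) = 0"
    by (simp add: integral_pmf_of_set)
  finally show ?thesis .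
qed

lemma prob_abs_coord_mean_ge:
  assumes "b \<ge> 0"
  shows "measure_pmf.prob (pmf_of_set (cube n)) {x. b \<le> \<bar>coord_mean n x\<bar>} \<le>
    2 * exp (- (real n * b\<^sup>2) / 2)"
proof (cases "n = 0")
  case True
  have "measure_pmf.prob (pmf_of_set (cube n)) {x. b \<le> \<bar>coord_mean n x\<bar>} \<le> 1"
    by (rule measure_pmf.prob_le_1)
  also have "1 \<le> 2 * exp (- (real n * b\<^sup>2) / 2)" using True by simp
  finally show ?thesis .
next
  case False
  let ?M = "pmf_of_set (cube n)"
  interpret Hoeffding_ineq "measure_pmf ?M" "{1..n}" "\<lambda>i x. x i" "\<lambda>_. -1" "\<lambda>_. 1" 0
  proof unfold_locales
    show "prob_space.indep_vars ?M (\<lambda>_. borel) (\<lambda>i x. x i) {1..n}"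
      unfolding pmf_of_set_cube
      by (intro prob_space.indep_vars_compose2[OF _ indep_vars_Pi_pmf])
         (auto simp: measure_pmf.prob_space_axioms)
    show "AE x in ?M. x i \<in> {-1..1}" if "i \<in> {1..n}" for i
      using that cube_coord by (intro AE_pmfI) (fastforce simp: cube_nonempty)
    show "0 \<equiv> \<Sum>i=1..n. measure_pmf.expectation ?M (\<lambda>x. x i)"
      by (simp add: expectation_coord_cube)
  qed simp
  have "{x. b \<le> \<bar>coord_mean n x\<bar>} = {x \<in> space ?M. real n * b \<le> \<bar>(\<Sum>i=1..n. x i) - 0\<bar>}"
    using False by (auto simp: coord_mean_def field_simps)
  also have "measure_pmf.prob ?M \<dots> \<le> 2 * exp (-2 * (real n * b)\<^sup>2 / (\<Sum>i=1..n. (1 - (-1))\<^sup>2))"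
    using assms False by (intro Hoeffding_ineq_abs_ge) auto
  also have "-2 * (real n * b)\<^sup>2 / (\<Sum>i=1..n. (1 - (-1))\<^sup>2) = - (real n * b\<^sup>2) / 2"
    using False by (simp add: power2_eq_square)
  finally show ?thesis .
qed

lemma influence_on_tail_le:
  assumes f: "f \<in> cube n \<rightarrow> {-M..M}" and "b \<ge> 0"
  shows "influence_on n f {x \<in> cube n. b \<le> \<bar>coord_mean n x\<bar>} \<le>
    sqrt 2 * M * sqrt (real (cube_degree n f) * real n) * exp (- (real n * b\<^sup>2) / 4)"
proof -
  let ?A = "{x \<in> cube n. b \<le> \<bar>coord_mean n x\<bar>}" and ?dn = "real (cube_degree n f) * real n"
  have "M \<ge> 0" by (rule cube_bound_nonneg[OF f])
  have "measure_pmf.prob (pmf_of_set (cube n)) ?A \<le>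
      measure_pmf.prob (pmf_of_set (cube n)) {x. b \<le> \<bar>coord_mean n x\<bar>}"
    by (rule measure_pmf.finite_measure_mono) auto
  also have "\<dots> \<le> 2 * exp (- (real n * b\<^sup>2) / 2)"
    by (rule prob_abs_coord_mean_ge[OF \<open>b \<ge> 0\<close>])
  also have "exp (- (real n * b\<^sup>2) / 2) = (exp (- (real n * b\<^sup>2) / 4))\<^sup>2"
    by (simp flip: exp_double)
  finally have prob: "measure_pmf.prob (pmf_of_set (cube n)) ?A \<le> 2 * (exp (- (real n * b\<^sup>2) / 4))\<^sup>2" .
  have "influence_on n f ?A \<le> M * sqrt (?dn * measure_pmf.prob (pmf_of_set (cube n)) ?A)"
    by (rule influence_on_le_sqrt_prob[OF f]) auto
  also have "\<dots> \<le> M * sqrt (?dn * (2 * (exp (- (real n * b\<^sup>2) / 4))\<^sup>2))"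
    using \<open>M \<ge> 0\<close> prob by (intro mult_left_mono real_sqrt_le_mono) auto
  also have "\<dots> = sqrt 2 * M * sqrt ?dn * exp (- (real n * b\<^sup>2) / 4)"
    by (simp add: real_sqrt_mult)
  finally show ?thesis .
qed

section \<open>Influence of symmetric functions\<close>

lemma coord_mean_flip:
  assumes "i \<in> {1..n}"
  shows "coord_mean n (x(i := - x i)) = coord_mean n x - 2 * x i / real n"
proof -
  have "(\<Sum>j=1..n. (x(i := - x i)) j) = - x i + (\<Sum>j\<in>{1..n} - {i}. x j)"
    by (subst sum.remove[OF _ assms]) (auto intro!: sum.cong)
  also have "(\<Sum>j\<in>{1..n} - {i}. x j) = (\<Sum>j=1..n. x j) - x i"
    using assms by (simp add: sum_diff1)
  finally show ?thesis by (simp add: coord_mean_def diff_divide_distrib)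
qed

lemma coord_mult_cube_deriv_eq_pderiv:
  assumes f: "\<forall>x\<in>cube n. f x = poly P (coord_mean n x)" and i: "i \<in> {1..n}" and x: "x \<in> cube n"
  shows "\<exists>\<xi>. \<bar>\<xi>\<bar> \<le> \<bar>coord_mean n x\<bar> + 2 / real n \<and> x i * cube_deriv f i x = poly (pderiv P) \<xi> / real n"
proof -
  define u v where "u = coord_mean n x" and "v = coord_mean n (x(i := - x i))"
  have diff: "u - v = 2 * x i / real n"
    by (simp add: u_def v_def coord_mean_flip[OF i])
  have "{min v u..max v u} \<subseteq> {\<xi>. \<bar>\<xi>\<bar> \<le> \<bar>u\<bar> + \<bar>u - v\<bar>}" by auto
  then obtain \<xi> where \<xi>: "\<bar>\<xi>\<bar> \<le> \<bar>u\<bar> + \<bar>u - v\<bar>"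
    and mvt: "poly P u - poly P v = (u - v) * poly (pderiv P) \<xi>"
    using poly_MVT'[of v u _ P] by blast
  have "\<bar>u - v\<bar> = 2 / real n"
    using cube_coord[OF x i] by (auto simp: diff)
  have "cube_deriv f i x = (poly P u - poly P v) / 2"
    using f x cube_flip[OF x i] by (simp add: cube_deriv_def u_def v_def)
  also have "\<dots> = x i * (poly (pderiv P) \<xi> / real n)" by (simp add: mvt diff)
  finally have "x i * cube_deriv f i x = poly (pderiv P) \<xi> / real n"
    using cube_coord_sq[OF x i] by (simp add: mult.assoc[symmetric])
  with \<xi> \<open>\<bar>u - v\<bar> = 2 / real n\<close> show ?thesis by (auto simp: u_def)
qed

lemma ex_cube_coord_mean:
  assumes "m \<le> n"
  shows "\<exists>x\<in>cube n. coord_mean n x = (real n - 2 * real m) / real n"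
proof (intro bexI)
  let ?x = "\<lambda>i\<in>{1..n}. if i \<le> m then -1 else 1 :: real"
  show "?x \<in> cube n" by (auto simp: cube_def)
  have "(\<Sum>i=1..n. ?x i) = (\<Sum>i=1..n. 1 - (if i \<in> {1..m} then 2 else 0))"
    by (intro sum.cong) auto
  also have "\<dots> = real n - (\<Sum>i\<in>{1..n} \<inter> {1..m}. 2)"
    by (simp only: sum_subtractf sum.inter_restrict[symmetric] finite_atLeastAtMost) simp
  also have "{1..n} \<inter> {1..m} = {1..m}" using assms by auto
  finally show "coord_mean n ?x = (real n - 2 * real m) / real n"
    by (simp add: coord_mean_def)
qed

lemma abs_poly_le_of_cube:
  fixes P :: "real poly"
  assumes f: "f \<in> cube n \<rightarrow> {-M..M}" and fP: "\<forall>x\<in>cube n. f x = poly P (coord_mean n x)"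
    and deg: "degree P \<le> d" and n: "n > 0" "16 * (real d)\<^sup>2 \<le> real n" and u: "\<bar>u\<bar> \<le> 1"
  shows "\<bar>poly P u\<bar> \<le> 2 * M"
proof (rule abs_poly_le_of_grid[OF deg n _ u])
  fix m assume "m \<le> n"
  then obtain x where x: "x \<in> cube n" "coord_mean n x = (real n - 2 * real m) / real n"
    using ex_cube_coord_mean by blast
  have "f x \<in> {-M..M}" using f x(1) by blast
  then show "\<bar>poly P ((real n - 2 * real m) / real n)\<bar> \<le> M"
    using fP x by (metis abs_le_iff atLeastAtMost_iff minus_le_iff)
qed

lemma total_influence_le_of_degree_le_1:
  assumes f: "f \<in> cube n \<rightarrow> {-M..M}" and sym: "cube_symmetric n f" and deg: "cube_degree n f \<le> 1"
  shows "total_influence n f \<le> real (cube_degree n f) * M"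
proof -
  obtain P where P: "degree P \<le> cube_degree n f" "\<forall>x\<in>cube n. f x = poly P (coord_mean n x)"
    using cube_symmetric_eq_poly_coord_mean[OF sym] by blast
  have "degree (pderiv P) = 0" using P(1) deg by (simp add: degree_pderiv)
  then obtain c where c: "pderiv P = [:c:]" by (rule degree_eq_zeroE)
  have "0 \<le> (if c \<ge> 0 then 1 else -1) * (x i * cube_deriv f i x)" if "i \<in> {1..n}" "x \<in> cube n" for i x
    using coord_mult_cube_deriv_eq_pderiv[OF P(2) that] by (auto simp: c)
  then have "total_influence n f \<le> real (cube_degree n f) * M + 2 * influence_on n f (cube n - cube n)"
    by (intro total_influence_le_of_constant_sign[OF f]) auto
  then show ?thesis by (simp add: influence_on_def)
qed

lemma total_influence_le_window:
  assumes f: "f \<in> cube n \<rightarrow> {-M..M}" and fP: "\<forall>x\<in>cube n. f x = poly P (coord_mean n x)"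
    and deg: "degree P \<le> cube_degree n f" and bound: "\<forall>u. \<bar>u\<bar> \<le> 1 \<longrightarrow> \<bar>poly P u\<bar> \<le> K"
    and a: "0 \<le> a" "a \<le> 1 / 4"
    and W: "W \<subseteq> cube n" "\<And>x. x \<in> W \<Longrightarrow> \<bar>coord_mean n x\<bar> + 2 / real n \<le> a"
  shows "total_influence n f \<le>
    max (real (cube_degree n f) * M) (3 * a * (real (cube_degree n f))\<^sup>2 * K) +
    2 * influence_on n f (cube n - W)" (is "_ \<le> max ?r ?s + 2 * ?tail")
proof -
  have mean_value: "\<exists>\<xi>. \<bar>\<xi>\<bar> \<le> a \<and> x i * cube_deriv f i x = poly (pderiv P) \<xi> / real n"
    if "i \<in> {1..n}" "x \<in> W" for i x
    using coord_mult_cube_deriv_eq_pderiv[OF fP that(1), of x] W that(2)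
    by (meson order_trans subsetD)
  from deg bound a(2) show ?thesis
  proof (cases rule: pderiv_constant_sign_or_small)
    case (constant_sign \<epsilon>)
    have "0 \<le> \<epsilon> * (x i * cube_deriv f i x)" if "i \<in> {1..n}" "x \<in> W" for i x
      using mean_value[OF that] constant_sign(2) by auto
    from total_influence_le_of_constant_sign[OF f W(1) constant_sign(1) this]
    have "total_influence n f \<le> ?r + 2 * ?tail" .
    then show ?thesis by linarith
  next
    case small
    have "\<bar>cube_deriv f i x\<bar> \<le> ?s / real n" if "i \<in> {1..n}" "x \<in> W" for i x
    proof -
      obtain \<xi> where \<xi>: "\<bar>\<xi>\<bar> \<le> a" "x i * cube_deriv f i x = poly (pderiv P) \<xi> / real n"
        using mean_value[OF \<open>i \<in> {1..n}\<close> \<open>x \<in> W\<close>] by blast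
      have "\<bar>cube_deriv f i x\<bar> = \<bar>poly (pderiv P) \<xi>\<bar> / real n"
        using abs_coord_mult[of x n i "cube_deriv f i x"] that W(1) \<xi>(2) by auto
      then show ?thesis using small[OF \<xi>(1)] by (simp add: divide_right_mono)
    qed
    moreover have "0 \<le> ?s"
      using spec[OF bound, of 0] a(1) by simp
    ultimately have "total_influence n f \<le> ?s + ?tail"
      by (intro total_influence_le_of_small_deriv[OF W(1)])
    moreover have "?tail \<ge> 0"
      by (simp add: influence_on_def sum_nonneg)
    ultimately show ?thesis by linarith
  qed
qed

lemma total_influence_symmetric_le:
  assumes f: "f \<in> cube n \<rightarrow> {-M..M}" and sym: "cube_symmetric n f"
    and d: "cube_degree n f = d" "2 \<le> d" and n: "16 * (real d)\<^sup>2 \<le> real n"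
  defines "b \<equiv> 1 / (4 * (real d)\<^sup>2) - 2 / real n"
  shows "total_influence n f \<le>
    real d * M + 2 * (sqrt 2 * M * sqrt (real d * real n) * exp (- (real n * b\<^sup>2) / 4))"
proof -
  have d_sq: "(real d)\<^sup>2 > 0" using d(2) by simp
  then have "n > 0" using n by (cases n) auto
  have "M \<ge> 0" by (rule cube_bound_nonneg[OF f])
  have "8 * (real d)\<^sup>2 \<le> real n" using n d_sq by linarith
  then have "2 / real n \<le> 2 / (8 * (real d)\<^sup>2)"
    using d_sq by (intro frac_le) auto
  then have "b \<ge> 0" by (simp add: b_def)
  obtain P where P: "degree P \<le> d" "\<forall>x\<in>cube n. f x = poly P (coord_mean n x)"
    using cube_symmetric_eq_poly_coord_mean[OF sym] d(1) by blast
  have P_bound: "\<forall>u. \<bar>u\<bar> \<le> 1 \<longrightarrow> \<bar>poly P u\<bar> \<le> 2 * M"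
    using abs_poly_le_of_cube[OF f P(2,1) \<open>n > 0\<close> n] by blast
  define a where "a = 1 / (4 * (real d)\<^sup>2)"
  have a: "0 \<le> a" "a \<le> 1 / 4" using d(2) by (simp_all add: a_def divide_le_eq)
  define W where "W = {x \<in> cube n. \<bar>coord_mean n x\<bar> < b}"
  have W: "W \<subseteq> cube n" "\<And>x. x \<in> W \<Longrightarrow> \<bar>coord_mean n x\<bar> + 2 / real n \<le> a"
    by (auto simp: W_def a_def b_def)
  have "total_influence n f \<le>
      max (real d * M) (3 * a * (real d)\<^sup>2 * (2 * M)) + 2 * influence_on n f (cube n - W)"
    using total_influence_le_window[OF f P(2) _ P_bound a W] P(1) d(1) by simp
  also have "3 * a * (real d)\<^sup>2 * (2 * M) = 3 / 2 * M"
    using d(2) by (simp add: a_def)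
  also have "max (real d * M) (3 / 2 * M) = real d * M"
    using d(2) \<open>M \<ge> 0\<close> by (intro max_absorb1 mult_right_mono) auto
  also have "cube n - W = {x \<in> cube n. b \<le> \<bar>coord_mean n x\<bar>}" by (auto simp: W_def)
  also have "influence_on n f \<dots> \<le> sqrt 2 * M * sqrt (real d * real n) * exp (- (real n * b\<^sup>2) / 4)"
    using influence_on_tail_le[OF f \<open>b \<ge> 0\<close>] d(1) by simp
  finally show ?thesis by simp
qed

lemma sixteen_sq_le_quartic_ln:
  assumes "2 \<le> d"
  shows "16 * (real d)\<^sup>2 \<le> 64 * real d ^ 4 * ln (real d)"
proof -
  have "4 \<le> (real d)\<^sup>2" using power_mono[of 2 "real d" 2] assms by simp
  moreover have "1 / 2 \<le> ln (real d)"
    using ln2_ge_two_thirds ln_le_cancel_iff[of 2 "real d"] assms by linarith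
  ultimately have "64 * ((real d)\<^sup>2 * 4) * (1 / 2) \<le> 64 * ((real d)\<^sup>2 * (real d)\<^sup>2) * ln (real d)"
    by (intro mult_mono) auto
  also have "(real d)\<^sup>2 * (real d)\<^sup>2 = real d ^ 4"
    by (simp flip: power_add)
  finally show ?thesis
    using zero_le_power2[of "real d"] by linarith
qed

theorem theorem3p12:
  shows "\<exists>C::real. \<forall>(n::nat) (d::nat) (f :: (nat \<Rightarrow> real) \<Rightarrow> real).
    f \<in> cube n \<rightarrow> {-1..1} \<longrightarrow>
    cube_symmetric n f \<longrightarrow>
    cube_degree n f = d \<longrightarrow>
    real n \<ge> 64 * real d ^ 4 * ln (real d) \<longrightarrow>
    (let t = sqrt (real n) * (1 / (4 * real d ^ 2) - 2 / real n)
     in total_influence n f \<le> real d + C * sqrt (real d * real n) * exp (- (t ^ 2) / 4))"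
proof (intro exI allI impI, unfold Let_def)
  fix n d :: nat and f :: "(nat \<Rightarrow> real) \<Rightarrow> real"
  assume f: "f \<in> cube n \<rightarrow> {-1..1}" "cube_symmetric n f" and d: "cube_degree n f = d"
    and n: "real n \<ge> 64 * real d ^ 4 * ln (real d)"
  let ?t = "sqrt (real n) * (1 / (4 * real d ^ 2) - 2 / real n)"
  show "total_influence n f \<le> real d + 2 * sqrt 2 * sqrt (real d * real n) * exp (- (?t ^ 2) / 4)"
  proof (cases "2 \<le> d")
    case True
    have "16 * (real d)\<^sup>2 \<le> real n"
      using sixteen_sq_le_quartic_ln[OF True] n by (rule order_trans)
    from total_influence_symmetric_le[OF f d True this] show ?thesis
      by (simp add: power_mult_distrib mult.assoc)
  next
    case False
    then have "total_influence n f \<le> real d"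
      using total_influence_le_of_degree_le_1[OF f] d by simp
    also have "\<dots> \<le> real d + 2 * sqrt 2 * sqrt (real d * real n) * exp (- (?t ^ 2) / 4)"
      by simp
    finally show ?thesis .
  qed
qed

end
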